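(* Let $G$ be a Cohen--Macaulay very well-covered graph with $2n$ vertices $x_1,\dots,x_n,y_1,\dots,y_n$ in standard labelling. Then $$\beta_i(I(G)^\vee)=\sum_{C\in\mathcal C(G)}\binom{|\mathcal C(G;C)|}{i}\quad\text{for all } i\ge 0,\qquad \mathrm{pd}(I(G)^\vee)=\max\{|\mathcal C(G;C)| : C\in\mathcal C(G)\}.$$ In particular, the graded Betti numbers of $I(G)^\vee$ do not depend on the characteristic of the underlying field $K$.
   Context: Graphs are finite, simple and undirected. $K$ is a field, $S=K[x_1,\dots,x_n,y_1,\dots,y_n]$, and vertices of $G$ are identified with variables of $S$. The edge ideal $I(G)$ is generated by the products of the endpoints of edges of $G$; the cover ideal $I(G)^\vee$ is generated by the monomials $\prod_{z\in C}z$, $C$ a minimal vertex cover of $G$. $G$ is unmixed if all minimal vertex covers have the same cardinality; $G$ is very well-covered if it is unmixed, has no isolated vertices, and $2\,\mathrm{height}(I(G))=|V(G)|$; $G$ is Cohen--Macaulay if $S/I(G)$ is a Cohen--Macaulay ring. $\beta_i$ denotes the $i$-th total Betti number and $\mathrm{pd}$ the projective dimension over $S$. Standard labelling: a Cohen--Macaulay very well-covered graph with $2n$ vertices always admits a labelling $V(G)=\{x_1,\dots,x_n,y_1,\dots,y_n\}$ such that: (i) $X=\{x_1,\dots,x_n\}$ is a minimal vertex cover and $Y=\{y_1,\dots,y_n\}$ is a maximal independent set; (ii) $x_iy_i\in E(G)$ for all $i$; (iii) if $x_iy_j\in E(G)$ then $i\le j$; (iv) if $x_iy_j\in E(G)$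 then $x_ix_j\notin E(G)$; (v) if $z_ix_j,\,y_jx_k\in E(G)$ then $z_ix_k\in E(G)$, for any distinct $i,j,k$ and $z_i\in\{x_i,y_i\}$. Any labelling satisfying (i)--(v) is called standard. $\mathcal C(G)$ is the set of minimal vertex covers of $G$. For $C\in\mathcal C(G)$, $\mathcal C(G;C)=\{x_s: y_s\in C\text{ and }(C\setminus\{y_s\})\cup\{x_s\}\in\mathcal C(G)\}$. *)

theory Defs
  imports
    "HOL-Library.Poly_Mapping"
    "HOL-Library.Extended_Nat"
    "HOL-Algebra.Algebra"
    "HOL-Algebra.Algebraic_Closure_Type"
    "Jordan_Normal_Form.Matrix"
begin

section \<open>Graphs\<close>

text \<open>
  A finite simple graph is given by its set \<open>E\<close> of edges (two-element sets) on the vertex set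
  \<open>UNIV :: 'v set\<close> of a nonempty finite type \<open>'v\<close>. The vertices are the variables of the
  polynomial ring.
\<close>

definition simple_graph :: "'v::finite set set \<Rightarrow> bool" where
  "simple_graph E \<longleftrightarrow> (\<forall>e\<in>E. card e = 2)"

definition vertex_cover :: "'v set set \<Rightarrow> 'v set \<Rightarrow> bool" where
  "vertex_cover E C \<longleftrightarrow> (\<forall>e\<in>E. e \<inter> C \<noteq> {})"

definition min_vertex_covers :: "'v set set \<Rightarrow> 'v set set" where
  "min_vertex_covers E = {C. vertex_cover E C \<and> (\<forall>D. D \<subset> C \<longrightarrow> \<not> vertex_cover E D)}"

definition independent_set :: "'v set set \<Rightarrow> 'v set \<Rightarrow> bool" where
  "independent_set E A \<longleftrightarrow> (\<forall>e\<in>E. \<not> e \<subseteq> A)"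

definition max_independent_set :: "'v set set \<Rightarrow> 'v set \<Rightarrow> bool" where
  "max_independent_set E A \<longleftrightarrow>
     independent_set E A \<and> (\<forall>B. A \<subset> B \<longrightarrow> \<not> independent_set E B)"

definition unmixed :: "'v set set \<Rightarrow> bool" where
  "unmixed E \<longleftrightarrow> (\<forall>C\<in>min_vertex_covers E. \<forall>D\<in>min_vertex_covers E. card C = card D)"

definition no_isolated_vertices :: "'v set set \<Rightarrow> bool" where
  "no_isolated_vertices E \<longleftrightarrow> (\<forall>v. \<exists>e\<in>E. v \<in> e)"

section \<open>Commutative algebra\<close>

definition prime_height :: "('a, 'm) ring_scheme \<Rightarrow> 'a set \<Rightarrow> enat" where
  "prime_height R P =
     Sup {enat r | r. \<exists>p. (\<forall>i\<le>r. primeideal (p i) R) \<and> (\<forall>i<r. p i \<subset> p (Suc i)) \<and> p r = P}"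

definition ideal_height :: "('a, 'm) ring_scheme \<Rightarrow> 'a set \<Rightarrow> enat" where
  "ideal_height R I = Inf {prime_height R P | P. primeideal P R \<and> I \<subseteq> P}"

definition regular_sequence :: "('a, 'm) ring_scheme \<Rightarrow> 'a list \<Rightarrow> bool" where
  "regular_sequence R fs \<longleftrightarrow>
     set fs \<subseteq> carrier R \<and>
     (\<forall>i<length fs. \<forall>r\<in>carrier R.
        fs ! i \<otimes>\<^bsub>R\<^esub> r \<in> Idl\<^bsub>R\<^esub> (set (take i fs)) \<longrightarrow> r \<in> Idl\<^bsub>R\<^esub> (set (take i fs))) \<and>
     Idl\<^bsub>R\<^esub> (set fs) \<noteq> carrier R"

definition ideal_depth :: "('a, 'm) ring_scheme \<Rightarrow> 'a set \<Rightarrow> enat" where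
  "ideal_depth R I = Sup {enat (length fs) | fs. regular_sequence R fs \<and> set fs \<subseteq> I}"

text \<open>
  Eisenbud's definition: a Noetherian ring is Cohen--Macaulay if the depth of every maximal ideal
  (the supremum of the lengths of regular sequences it contains) equals its height. For a maximal
  ideal these two numbers are the depth and the Krull dimension of the localization.
\<close>

definition cohen_macaulay_ring :: "('a, 'm) ring_scheme \<Rightarrow> bool" where
  "cohen_macaulay_ring R \<longleftrightarrow>
     cring R \<and> noetherian_ring R \<and>
     (\<forall>m. maximalideal m R \<longrightarrow> ideal_depth R m = prime_height R m)"

section \<open>Polynomial rings and monomial ideals\<close>

type_synonym ('v, 'k) mpoly = "('v \<Rightarrow>\<^sub>0 nat) \<Rightarrow>\<^sub>0 'k"

abbreviation poly_ring :: "('v::finite, 'k::field) mpoly ring" where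
  "poly_ring \<equiv> ring_of_type_algebra"

definition var :: "'v::finite \<Rightarrow> ('v, 'k::field) mpoly" where
  "var v = Poly_Mapping.single (Poly_Mapping.single v 1) 1"

definition mon_degree :: "('v::finite \<Rightarrow>\<^sub>0 nat) \<Rightarrow> nat" where
  "mon_degree m = (\<Sum>v\<in>UNIV. Poly_Mapping.lookup m v)"

definition edge_ideal :: "'v::finite set set \<Rightarrow> ('v, 'k::field) mpoly set" where
  "edge_ideal E = Idl\<^bsub>poly_ring\<^esub> ((\<lambda>e. \<Prod>v\<in>e. var v) ` E)"

definition cover_ideal :: "'v::finite set set \<Rightarrow> ('v, 'k::field) mpoly set" where
  "cover_ideal E = Idl\<^bsub>poly_ring\<^esub> ((\<lambda>C. \<Prod>v\<in>C. var v) ` min_vertex_covers E)"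

text \<open>The \<open>itself\<close> argument carries the coefficient field.\<close>

definition very_well_covered :: "'k::field itself \<Rightarrow> 'v::finite set set \<Rightarrow> bool" where
  "very_well_covered TYPE('k) E \<longleftrightarrow>
     unmixed E \<and> no_isolated_vertices E \<and>
     2 * ideal_height poly_ring (edge_ideal E :: ('v, 'k) mpoly set) = enat (card (UNIV :: 'v set))"

definition cohen_macaulay_graph :: "'k::field itself \<Rightarrow> 'v::finite set set \<Rightarrow> bool" where
  "cohen_macaulay_graph TYPE('k) E \<longleftrightarrow>
     cohen_macaulay_ring (poly_ring Quot (edge_ideal E :: ('v, 'k) mpoly set))"

section \<open>Resolutions, Betti numbers, projective dimension\<close>

text \<open>
  A resolution of an ideal \<open>I\<close> of \<open>S\<close>: modules \<open>P i \<subseteq> S\<^bsup>r i\<^esup>\<close> and an exact sequence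
  \<open>\<dots> \<rightarrow> P 1 \<rightarrow> P 0 \<rightarrow> I \<rightarrow> 0\<close>, whose maps are restrictions of the matrices \<open>A i\<close>. The matrix
  \<open>A 0\<close> has one row and is the augmentation, with \<open>I\<close> regarded as a submodule of \<open>S\<^bsup>1\<^esup>\<close>.
\<close>

definition resolution ::
  "'a::comm_ring_1 set \<Rightarrow> (nat \<Rightarrow> nat) \<Rightarrow> (nat \<Rightarrow> 'a vec set) \<Rightarrow> (nat \<Rightarrow> 'a mat) \<Rightarrow> bool" where
  "resolution I r P A \<longleftrightarrow>
     (\<forall>i. P i \<subseteq> carrier_vec (r i)) \<and>
     A 0 \<in> carrier_mat 1 (r 0) \<and>
     (\<forall>i. A (Suc i) \<in> carrier_mat (r i) (r (Suc i))) \<and>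
     (\<lambda>v. A 0 *\<^sub>v v) ` P 0 = {vec 1 (\<lambda>_. f) | f. f \<in> I} \<and>
     (\<forall>i. (\<lambda>v. A (Suc i) *\<^sub>v v) ` P (Suc i) = {v \<in> P i. A i *\<^sub>v v = 0\<^sub>v (dim_row (A i))})"

text \<open>
  The \<open>i\<close>-th module is the graded free module \<open>\<Oplus>\<^sub>p S(-d i ! p)\<close>, and \<open>A\<close> has degree 0: a monomial
  in entry \<open>(p, q)\<close> of \<open>A (Suc i)\<close> has degree \<open>d (Suc i) ! q - d i ! p\<close>. The last condition is
  minimality: the entries of \<open>A (Suc i)\<close> lie in the graded maximal ideal.
\<close>

definition minimal_graded_free_resolution ::
  "('v::finite, 'k::field) mpoly set \<Rightarrow> (nat \<Rightarrow> int list) \<Rightarrow> (nat \<Rightarrow> ('v, 'k) mpoly mat) \<Rightarrow> bool"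
where
  "minimal_graded_free_resolution I d A \<longleftrightarrow>
     resolution I (\<lambda>i. length (d i)) (\<lambda>i. carrier_vec (length (d i))) A \<and>
     (\<forall>q<length (d 0). \<forall>m\<in>Poly_Mapping.keys (A 0 $$ (0, q)). int (mon_degree m) = d 0 ! q) \<and>
     (\<forall>i. \<forall>p<length (d i). \<forall>q<length (d (Suc i)).
        \<forall>m\<in>Poly_Mapping.keys (A (Suc i) $$ (p, q)). int (mon_degree m) = d (Suc i) ! q - d i ! p) \<and>
     (\<forall>i. \<forall>p<length (d i). \<forall>q<length (d (Suc i)). Poly_Mapping.lookup (A (Suc i) $$ (p, q)) 0 = 0)"

text \<open>
  The shifts of a minimal graded free resolution, which up to reordering depend only on the
  (homogeneous) ideal.
\<close>

definition minimal_shifts :: "('v::finite, 'k::field) mpoly set \<Rightarrow> nat \<Rightarrow> int list" where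
  "minimal_shifts I = (SOME d. \<exists>A. minimal_graded_free_resolution I d A)"

definition graded_betti :: "nat \<Rightarrow> int \<Rightarrow> ('v::finite, 'k::field) mpoly set \<Rightarrow> nat" where
  "graded_betti i j I = count_list (minimal_shifts I i) j"

definition betti :: "nat \<Rightarrow> ('v::finite, 'k::field) mpoly set \<Rightarrow> nat" where
  "betti i I = length (minimal_shifts I i)"

text \<open>
  Direct summands of \<open>S\<^sup>r\<close>, i.e. images of idempotent matrices, are up to isomorphism the finitely
  generated projective modules. A linear map between two such modules is the restriction of a
  matrix. Over a Noetherian ring these modules suffice to compute the projective dimension
  of an ideal.
\<close>

definition projective_summand :: "nat \<Rightarrow> 'a::comm_ring_1 vec set \<Rightarrow> bool" where
  "projective_summand r P \<longleftrightarrow>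
     (\<exists>e\<in>carrier_mat r r. e * e = e \<and> P = (\<lambda>v. e *\<^sub>v v) ` carrier_vec r)"

definition projective_dimension :: "'a::comm_ring_1 set \<Rightarrow> enat" where
  "projective_dimension I =
     Inf {enat l | l. \<exists>r P A. resolution I r P A \<and> (\<forall>i. projective_summand (r i) (P i)) \<and>
                       (\<forall>i>l. P i = {0\<^sub>v (r i)})}"

section \<open>Standard labellings\<close>

text \<open>
  The vertices are \<open>x 1, \<dots>, x n, y 1, \<dots>, y n\<close>. Values of \<open>x\<close> and \<open>y\<close> outside \<open>{1..n}\<close> are
  irrelevant.
\<close>

definition standard_labelling ::
  "'v::finite set set \<Rightarrow> nat \<Rightarrow> (nat \<Rightarrow> 'v) \<Rightarrow> (nat \<Rightarrow> 'v) \<Rightarrow> bool" where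
  "standard_labelling E n x y \<longleftrightarrow>
     inj_on x {1..n} \<and> inj_on y {1..n} \<and>
     x ` {1..n} \<inter> y ` {1..n} = {} \<and> x ` {1..n} \<union> y ` {1..n} = UNIV \<and>
     x ` {1..n} \<in> min_vertex_covers E \<and> max_independent_set E (y ` {1..n}) \<and>
     (\<forall>i\<in>{1..n}. {x i, y i} \<in> E) \<and>
     (\<forall>i\<in>{1..n}. \<forall>j\<in>{1..n}. {x i, y j} \<in> E \<longrightarrow> i \<le> j) \<and>
     (\<forall>i\<in>{1..n}. \<forall>j\<in>{1..n}. {x i, y j} \<in> E \<longrightarrow> {x i, x j} \<notin> E) \<and>
     (\<forall>i\<in>{1..n}. \<forall>j\<in>{1..n}. \<forall>k\<in>{1..n}. i \<noteq> j \<and> j \<noteq> k \<and> i \<noteq> k \<longrightarrow>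
        (\<forall>z\<in>{x i, y i}. {z, x j} \<in> E \<and> {y j, x k} \<in> E \<longrightarrow> {z, x k} \<in> E))"

text \<open>The set \<open>C(G; C)\<close>, relative to the labelling \<open>x, y\<close>.\<close>

definition cover_exchanges ::
  "'v set set \<Rightarrow> nat \<Rightarrow> (nat \<Rightarrow> 'v) \<Rightarrow> (nat \<Rightarrow> 'v) \<Rightarrow> 'v set \<Rightarrow> 'v set" where
  "cover_exchanges E n x y C =
     {x s | s. s \<in> {1..n} \<and> y s \<in> C \<and> (C - {y s}) \<union> {x s} \<in> min_vertex_covers E}"

end

theory Submission
  imports Defs "Jordan_Normal_Form.Determinant"
begin

text \<open>
  By unmixedness a minimal vertex cover contains exactly one of \<open>x i, y i\<close> for each \<open>i\<close>, so it is given by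
  the set \<open>C \<subseteq> {1..n}\<close> of indices of its \<open>y\<close>-vertices. Exchanging \<open>y s\<close> for \<open>x s\<close> removes \<open>s\<close> from \<open>C\<close>, and
  exchanges in different directions are independent: the covers \<open>C - T\<close> with \<open>T\<close> a set of
  exchangeable indices form a cube. The cellular complex with basis all pairs \<open>(C, T)\<close> in homological
  degree \<open>card T\<close> resolves the cover ideal over any field: filtering by \<open>card C\<close>, the successive
  quotients are Koszul complexes on the variables \<open>x s\<close> with \<open>s\<close> exchangeable in \<open>C\<close>, and these
  variables generate the colon ideal of the generator of \<open>C\<close> modulo the preceding ones. The
  differentials are linear, so the resolution is minimal. Betti numbers and projective dimension
  can be read off it because every map of complexes from a minimal free resolution to itself that
  lifts the identity, in particular one that factors through another projective resolution, is the
  identity modulo the maximal ideal.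
\<close>

section \<open>Koszul complexes\<close>

text \<open>One obstacle shapes the algebra: \<open>minimal_shifts\<close> is picked by choice among
  all minimal graded free resolutions, and \<open>projective_dimension\<close> is an infimum over
  all projective ones. Exhibiting one resolution therefore settles neither invariant, and an
  arbitrary competitor has to be compared with the constructed complex. Linearity helps here: all
  shifts in one homological degree coincide, so the list of shifts itself is determined, not merely
  its reordering class. On the combinatorial side, write i -> j if \<open>x i\<close> and
  \<open>y j\<close> are adjacent. Index sets of covers are the sets closed under these arrows that
  contain no i, j with \<open>x i\<close>, \<open>x j\<close> adjacent. Such sets are stable under
  intersection, which is why exchanges are independent. Arrows never decrease the index, so the
  least element of \<open>C - D\<close> is exchangeable in \<open>C\<close>; this yields the colon
  ideals. No integer is ever inverted, and ranks and shifts are purely combinatorial, hence the same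
  over every field.\<close>

definition koszul_sign :: "nat \<Rightarrow> nat set \<Rightarrow> 'a::comm_ring_1" where
  "koszul_sign s T = (- 1) ^ card {t\<in>T. t < s}"

text \<open>Chains are coefficient functions, so the value at \<open>T\<close> gathers all basis
  elements \<open>insert s T\<close> that have \<open>T\<close> as a face. \<open>N\<close> merely
  bounds the sum; the actual set of directions is carried by the support of
  \<open>w\<close>.\<close>

definition koszul_diff ::
  "nat set \<Rightarrow> (nat \<Rightarrow> 'a::comm_ring_1) \<Rightarrow> (nat set \<Rightarrow> 'a) \<Rightarrow> nat set \<Rightarrow> 'a" where
  "koszul_diff N x w T = (\<Sum>s\<in>N - T. koszul_sign s T * x s * w (insert s T))"

lemma koszul_sign_insert_less:
  assumes "s < t" "s \<notin> T" "finite T"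
  shows "koszul_sign t (insert s T) = - (koszul_sign t T :: 'a::comm_ring_1)"
proof -
  have "{r\<in>insert s T. r < t} = insert s {r\<in>T. r < t}" using assms by auto
  then show ?thesis using assms by (simp add: koszul_sign_def)
qed

lemma koszul_sign_insert_greater:
  assumes "\<not> s < t"
  shows "koszul_sign t (insert s T) = koszul_sign t T"
proof -
  have "{r\<in>insert s T. r < t} = {r\<in>T. r < t}" using assms by auto
  then show ?thesis by (simp add: koszul_sign_def)
qed

text \<open>Exactly one of \<open>s\<close>, \<open>t\<close> is counted in the sign of the other,
  namely the smaller one, so reversing the order of two insertions costs one sign.\<close>

lemma koszul_sign_swap:
  assumes "s \<noteq> t" "s \<notin> T" "t \<notin> T" "finite T"
  shows "koszul_sign s T * koszul_sign t (insert s T) =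
    - (koszul_sign t T * koszul_sign s (insert t T) :: 'a::comm_ring_1)"
  using assms
  by (cases "s < t") (auto simp: koszul_sign_insert_less koszul_sign_insert_greater)

text \<open>The Koszul complex on \<open>insert s U\<close> is the mapping cone of multiplication by
  \<open>x s\<close> on the one for \<open>U\<close>: \<open>q\<close> is the part through
  \<open>s\<close>, with \<open>s\<close> removed, and \<open>r\<close> the part avoiding
  \<open>s\<close>.\<close>

definition cone_chain :: "nat \<Rightarrow> (nat set \<Rightarrow> 'a) \<Rightarrow> (nat set \<Rightarrow> 'a) \<Rightarrow> nat set \<Rightarrow> 'a" where
  "cone_chain s r q T = (if s \<in> T then q (T - {s}) else r T)"

text \<open>Since \<open>s\<close> lies below all of \<open>U\<close>, its own sign is 1 and its
  presence flips the sign of every other direction. This gives the cone differential with no further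
  signs.\<close>

lemma koszul_diff_cone_chain:
  fixes x :: "nat \<Rightarrow> 'a::comm_ring_1"
  assumes N: "finite N" "s \<in> N" and U: "finite U" "\<And>t. t \<in> U \<Longrightarrow> s < t"
    and r: "\<And>T. r T \<noteq> 0 \<Longrightarrow> T \<subseteq> U" and q: "\<And>T. q T \<noteq> 0 \<Longrightarrow> T \<subseteq> U"
  shows "koszul_diff N x (cone_chain s r q) T =
    (if s \<in> T then - koszul_diff N x q (T - {s}) else x s * q T + koszul_diff N x r T)"
proof (cases "s \<in> T")
  case True
  then obtain T0 where T: "T = insert s T0" "s \<notin> T0" by (metis mk_disjoint_insert)
  have "s \<notin> U" using U(2) by blast
  then have "q (insert s T0) = 0" using q by blast
  then have "koszul_diff N x q T0 = (\<Sum>t\<in>N - T. koszul_sign t T0 * x t * q (insert t T0))"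
    unfolding koszul_diff_def using N by (intro sum.mono_neutral_right) (auto simp: T)
  also have "\<dots> = (\<Sum>t\<in>N - T. - (koszul_sign t T * x t * cone_chain s r q (insert t T)))"
  proof (rule sum.cong)
    fix t assume t: "t \<in> N - T"
    have ins: "insert t T - {s} = insert t T0" using T t by auto
    have "koszul_sign t T = - (koszul_sign t T0 :: 'a)" if "q (insert t T0) \<noteq> 0"
      using q[OF that] U T by (auto intro!: koszul_sign_insert_less finite_subset[OF _ U(1)])
    then show "koszul_sign t T0 * x t * q (insert t T0) =
      - (koszul_sign t T * x t * cone_chain s r q (insert t T))"
      using True by (cases "q (insert t T0) = 0") (auto simp: cone_chain_def ins)
  qed simp
  finally show ?thesis using T by (simp add: koszul_diff_def sum_negf)
next
  case False
  have s: "s \<notin> U" using U(2) by blast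
  then have r0: "r (insert s T) = 0" using r by blast
  have sgn: "koszul_sign s T = (1::'a)" if "q T \<noteq> 0"
  proof -
    have "{t\<in>T. t < s} = {}" using q[OF that] U(2) by force
    then show ?thesis by (simp only: koszul_sign_def) simp
  qed
  have "koszul_diff N x (cone_chain s r q) T = koszul_sign s T * x s * q T +
    (\<Sum>t\<in>N - T - {s}. koszul_sign t T * x t * cone_chain s r q (insert t T))"
    unfolding koszul_diff_def using N False
    by (subst sum.remove[of _ s]) (auto simp: cone_chain_def)
  also have "(\<Sum>t\<in>N - T - {s}. koszul_sign t T * x t * cone_chain s r q (insert t T)) =
    (\<Sum>t\<in>N - T - {s}. koszul_sign t T * x t * r (insert t T))"
    using False by (intro sum.cong) (auto simp: cone_chain_def)
  also have "\<dots> = koszul_diff N x r T"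
    unfolding koszul_diff_def using N r0 by (intro sum.mono_neutral_left) auto
  finally show ?thesis using False sgn by (cases "q T = 0") auto
qed

lemma koszul_exact_0:
  fixes x :: "nat \<Rightarrow> 'a::comm_ring_1"
  assumes "finite N" "U \<subseteq> N" and supp: "\<And>T. w T \<noteq> 0 \<Longrightarrow> T = {}"
    and aug: "w {} = (\<Sum>t\<in>U. x t * b t)"
  shows "\<exists>w'. (\<forall>T. w' T \<noteq> 0 \<longrightarrow> T \<subseteq> U \<and> card T = 1) \<and> koszul_diff N x w' = w"
proof -
  define w' where "w' T = (if \<exists>t\<in>U. T = {t} then b (the_elem T) else 0)" for T
  have "koszul_diff N x w' T = w T" for T
  proof (cases "T = {}")
    case True
    have "koszul_diff N x w' T = (\<Sum>t\<in>N. x t * w' {t})"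
      by (simp add: True koszul_diff_def koszul_sign_def)
    also have "\<dots> = (\<Sum>t\<in>U. x t * w' {t})"
      using assms(1,2) by (intro sum.mono_neutral_right) (auto simp: w'_def)
    also have "\<dots> = w {}" unfolding aug by (intro sum.cong) (auto simp: w'_def)
    finally show ?thesis by (simp add: True)
  next
    case False
    then have "koszul_diff N x w' T = 0"
      unfolding koszul_diff_def by (intro sum.neutral) (auto simp: w'_def)
    then show ?thesis using False supp by auto
  qed
  moreover have "\<forall>T. w' T \<noteq> 0 \<longrightarrow> T \<subseteq> U \<and> card T = 1"
    by (auto simp: w'_def split: if_splits)
  ultimately show ?thesis by blast
qed

text \<open>Induction along mapping cones, adding directions in decreasing order. In place of a long
  exact homology sequence the preimage is built by hand: first for the part through
  \<open>s\<close>, then for a corrected remainder. \<open>reg\<close> is assumed for every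
  \<open>V\<close> inside \<open>N\<close>, so that it applies at each stage.\<close>

lemma koszul_exact:
  fixes x :: "nat \<Rightarrow> 'a::comm_ring_1"
  assumes "finite N" "U \<subseteq> N"
    and reg: "\<And>V s w. V \<subseteq> N \<Longrightarrow> s \<in> N - V \<Longrightarrow> \<exists>b. x s * w = (\<Sum>t\<in>V. x t * b t) \<Longrightarrow>
      \<exists>b. w = (\<Sum>t\<in>V. x t * b t)"
    and supp: "\<And>T. w T \<noteq> 0 \<Longrightarrow> T \<subseteq> U \<and> card T = i"
    and cycle: "i > 0 \<Longrightarrow> koszul_diff N x w = (\<lambda>T. 0)"
    and aug: "i = 0 \<Longrightarrow> \<exists>b. w {} = (\<Sum>t\<in>U. x t * b t)"
  shows "\<exists>w'. (\<forall>T. w' T \<noteq> 0 \<longrightarrow> T \<subseteq> U \<and> card T = Suc i) \<and> koszul_diff N x w' = w"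
proof -
  have "finite U" using assms(1,2) finite_subset by blast
  then show ?thesis using assms(2) supp cycle aug
  proof (induction U arbitrary: w i rule: finite_linorder_min_induct)
    case empty
    then have "w = (\<lambda>T. 0)" by (cases "i = 0") fastforce+
    then show ?case by (intro exI[of _ "\<lambda>T. 0"]) (simp add: koszul_diff_def fun_eq_iff)
  next
    case (insert s U)
    have finU: "finite (insert s U)" and sU: "s \<notin> U" and sN: "s \<in> N" and UN: "U \<subseteq> N"
      using insert.hyps insert.prems(1) by auto
    show ?case
    proof (cases "i = 0")
      case True
      then obtain b where "w {} = (\<Sum>t\<in>insert s U. x t * b t)" using insert.prems(4) by blast
      moreover have "T = {}" if "w T \<noteq> 0" for T
        using insert.prems(2)[OF that] True finU finite_subset by fastforce
      ultimately show ?thesis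
        using koszul_exact_0[OF \<open>finite N\<close> insert.prems(1), of w x b] True by auto
    next
      case False
      define w0 where "w0 T = (if s \<in> T then 0 else w T)" for T
      define w1 where "w1 T = (if s \<in> T then 0 else w (insert s T))" for T
      have w: "w = cone_chain s w0 w1"
        by (auto simp: fun_eq_iff cone_chain_def w0_def w1_def insert_absorb)
      have w0_supp: "T \<subseteq> U \<and> card T = i" if "w0 T \<noteq> 0" for T
        using that insert.prems(2)[of T] by (auto simp: w0_def split: if_splits)
      have w1_supp: "T \<subseteq> U \<and> card T = i - 1" if "w1 T \<noteq> 0" for T
      proof -
        have "s \<notin> T" "insert s T \<subseteq> insert s U" "card (insert s T) = i"
          using that insert.prems(2)[of "insert s T"] by (auto simp: w1_def split: if_splits)
        moreover have "finite T"
          using finite_subset[OF \<open>insert s T \<subseteq> insert s U\<close> finU] by simp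
        ultimately show ?thesis by auto
      qed
      have diff: "koszul_diff N x (cone_chain s r q) T =
        (if s \<in> T then - koszul_diff N x q (T - {s}) else x s * q T + koszul_diff N x r T)"
        if "\<And>T. r T \<noteq> 0 \<Longrightarrow> T \<subseteq> U" "\<And>T. q T \<noteq> 0 \<Longrightarrow> T \<subseteq> U" for r q T
        using \<open>finite N\<close> sN insert.hyps that by (intro koszul_diff_cone_chain[where U = U]) auto
      have zero: "koszul_diff N x r T = 0" if "\<And>T. r T \<noteq> 0 \<Longrightarrow> T \<subseteq> U" "s \<in> T" for r T
      proof -
        have "r (insert t T) = 0" for t using that sU by blast
        then show ?thesis by (simp add: koszul_diff_def)
      qed
      have cyc: "koszul_diff N x (cone_chain s w0 w1) T = 0" for T
        using insert.prems(3) False w by simp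
      have diffw: "(if s \<in> T then - koszul_diff N x w1 (T - {s})
        else x s * w1 T + koszul_diff N x w0 T) = 0" for T
        using cyc[of T] diff[of w0 w1 T] w0_supp w1_supp by metis
      have d1: "koszul_diff N x w1 = (\<lambda>T. 0)"
      proof
        fix T show "koszul_diff N x w1 T = 0"
          using diffw[of "insert s T"] zero[of w1 T, OF w1_supp[THEN conjunct1]]
          by (cases "s \<in> T") auto
      qed
      have d0: "x s * w1 T + koszul_diff N x w0 T = 0" if "s \<notin> T" for T
        using diffw[of T] that by simp
      \<comment> \<open>This matters for \<open>i = 1\<close>, where \<open>w1\<close> is
        concentrated at \<open>{}\<close>: the cycle condition at \<open>{}\<close> puts
        \<open>x s * w1 {}\<close> into the ideal of the variables of \<open>U\<close>, and
        \<open>reg\<close> cancels \<open>x s\<close>.\<close>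
      have "\<exists>b. w1 {} = (\<Sum>t\<in>U. x t * b t)"
      proof (rule reg[OF UN])
        show "s \<in> N - U" using sU sN by simp
        have "koszul_diff N x w0 {} = (\<Sum>t\<in>N. x t * w0 {t})"
          by (simp add: koszul_diff_def koszul_sign_def)
        also have "\<dots> = (\<Sum>t\<in>U. x t * w0 {t})"
          using \<open>finite N\<close> UN w0_supp by (intro sum.mono_neutral_right) force+
        finally show "\<exists>b. x s * w1 {} = (\<Sum>t\<in>U. x t * b t)"
          using d0[of "{}"] by (intro exI[of _ "\<lambda>t. - w0 {t}"])
            (simp add: sum_negf eq_neg_iff_add_eq_0)
      qed
      then obtain q where q: "\<And>T. q T \<noteq> 0 \<Longrightarrow> T \<subseteq> U \<and> card T = i" "koszul_diff N x q = w1"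
        using insert.IH[of w1 "i - 1"] UN w1_supp d1 False by auto
      \<comment> \<open>The cone chain of \<open>r\<close> and \<open>- q\<close> has boundary
        \<open>w1\<close> through \<open>s\<close> and \<open>koszul_diff N x r - x s * q\<close>
        elsewhere, so \<open>r\<close> must bound \<open>w0 + x s * q\<close>. That is a cycle
        because the boundary of \<open>w0\<close> is \<open>- x s * w1\<close> and that of
        \<open>q\<close> is \<open>w1\<close>.\<close>
      define r0 where "r0 T = w0 T + x s * q T" for T
      have r0_supp: "T \<subseteq> U \<and> card T = i" if "r0 T \<noteq> 0" for T
        using that w0_supp[of T] q(1)[of T] by (cases "q T = 0") (auto simp: r0_def)
      have "koszul_diff N x r0 T = 0" for T
      proof (cases "s \<in> T")
        case True
        then show ?thesis using zero[of r0 T, OF r0_supp[THEN conjunct1]] by blast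
      next
        case False
        have "koszul_diff N x r0 T = koszul_diff N x w0 T + x s * koszul_diff N x q T"
          by (simp add: koszul_diff_def r0_def algebra_simps sum.distrib sum_distrib_left)
        then show ?thesis using d0[OF False] q(2) by (simp add: add.commute)
      qed
      then obtain r where r: "\<And>T. r T \<noteq> 0 \<Longrightarrow> T \<subseteq> U \<and> card T = Suc i" "koszul_diff N x r = r0"
        using insert.IH[of r0 i] UN r0_supp False by auto
      define w' where "w' = cone_chain s r (\<lambda>T. - q T)"
      have "T \<subseteq> insert s U \<and> card T = Suc i" if "w' T \<noteq> 0" for T
      proof (cases "s \<in> T")
        case True
        then have qT: "T - {s} \<subseteq> U" "card (T - {s}) = i"
          using that q(1)[of "T - {s}"] by (auto simp: w'_def cone_chain_def)
        then have "finite T" using finU finite_subset[of T "insert s U"] by auto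
        then show ?thesis using qT card_Suc_Diff1[OF _ True] by auto
      next
        case False
        then show ?thesis using that r(1)[of T] by (auto simp: w'_def cone_chain_def)
      qed
      moreover have "koszul_diff N x w' T = w T" for T
      proof -
        have "koszul_diff N x w' T = (if s \<in> T then - koszul_diff N x (\<lambda>T. - q T) (T - {s})
          else x s * - q T + koszul_diff N x r T)"
          unfolding w'_def by (rule diff) (use r(1) q(1) in auto)
        also have "koszul_diff N x (\<lambda>T. - q T) = (\<lambda>T. - w1 T)"
          by (simp add: q(2)[symmetric] koszul_diff_def fun_eq_iff sum_negf)
        finally show ?thesis
          by (auto simp: r(2) r0_def w0_def w1_def insert_absorb)
      qed
      ultimately show ?thesis by blast
    qed
  qed
qed

section \<open>The cubical complex of a set family\<close>

text \<open>A chain \<open>v\<close> assigns a coefficient to every basis element \<open>(C, T)\<close>, a cube with top vertex \<open>C\<close> in the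
  directions \<open>T\<close>. The face of \<open>(C, T)\<close> in direction \<open>s\<close> is \<open>x s * (C, T - {s}) - y s * (C - {s}, T - {s})\<close>;
  since \<open>insert s C = C\<close> for \<open>s \<in> C\<close>, both terms are collected by one formula.\<close>

definition cube_diff ::
  "nat set \<Rightarrow> (nat \<Rightarrow> 'a::comm_ring_1) \<Rightarrow> (nat \<Rightarrow> 'a) \<Rightarrow> (nat set \<Rightarrow> nat set \<Rightarrow> 'a) \<Rightarrow>
    nat set \<Rightarrow> nat set \<Rightarrow> 'a" where
  "cube_diff N x y v C T =
     (\<Sum>s\<in>N - T. koszul_sign s T * (if s \<in> C then x s else - y s) * v (insert s C) (insert s T))"

text \<open>The terms are cancelled in pairs; concluding from a sum being its own negative would
  fail in characteristic 2.\<close>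

lemma sum_antisymmetric_eq_0:
  fixes f :: "nat \<Rightarrow> nat \<Rightarrow> 'a::ab_group_add"
  assumes "finite M" "\<And>s t. s \<in> M \<Longrightarrow> t \<in> M \<Longrightarrow> s < t \<Longrightarrow> f t s = - f s t"
  shows "(\<Sum>s\<in>M. \<Sum>t\<in>M - {s}. f s t) = 0"
proof -
  have eq: "(\<Sum>t\<in>M - {s}. f s t) = (\<Sum>t\<in>{t\<in>M. s < t}. f s t) + (\<Sum>t\<in>{t\<in>M. t < s}. f s t)"
    for s
  proof -
    have "M - {s} = {t\<in>M. s < t} \<union> {t\<in>M. t < s}" by auto
    then show ?thesis using assms(1) by (simp add: sum.union_disjoint[symmetric] disjoint_iff)
  qed
  have "(\<Sum>s\<in>M. \<Sum>t\<in>{t\<in>M. t < s}. f s t) = (\<Sum>t\<in>M. \<Sum>s\<in>{s\<in>M. t < s}. f s t)"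
    using assms(1) by (rule sum.swap_restrict[OF _ assms(1), of M "\<lambda>s t. f s t" "\<lambda>s t. t < s"])
  also have "\<dots> = (\<Sum>t\<in>M. \<Sum>s\<in>{s\<in>M. t < s}. - f t s)"
    using assms(2) by (intro sum.cong) auto
  finally show ?thesis by (simp add: eq sum.distrib sum_negf)
qed

text \<open>For distinct \<open>s\<close> and \<open>t\<close>, inserting \<open>s\<close> into
  \<open>C\<close> does not affect whether \<open>t\<close> belongs to it. So the choice between
  \<open>x\<close> and \<open>y\<close> in one direction ignores the other, and only the Koszul
  signs decide.\<close>

lemma cube_diff_cube_diff:
  assumes "finite N" "finite T"
  shows "cube_diff N x y (cube_diff N x y v) C T = 0"
proof -
  let ?z = "\<lambda>s. if s \<in> C then x s else - y s"
  let ?f = "\<lambda>s t. koszul_sign s T * koszul_sign t (insert s T) * ?z s * ?z t *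
    v (insert t (insert s C)) (insert t (insert s T))"
  have "cube_diff N x y (cube_diff N x y v) C T = (\<Sum>s\<in>N - T. \<Sum>t\<in>(N - T) - {s}. ?f s t)"
    unfolding cube_diff_def sum_distrib_left
  proof (intro sum.cong)
    fix s t assume "s \<in> N - T" "t \<in> N - T - {s}"
    then show "koszul_sign s T * ?z s * (koszul_sign t (insert s T) *
      (if t \<in> insert s C then x t else - y t) * v (insert t (insert s C)) (insert t (insert s T))) =
      ?f s t" by (simp add: algebra_simps)
  qed auto
  also have "\<dots> = 0"
  proof (rule sum_antisymmetric_eq_0)
    fix s t assume st: "s \<in> N - T" "t \<in> N - T" "s < t"
    have "koszul_sign t T * koszul_sign s (insert t T) =
      - (koszul_sign s T * koszul_sign t (insert s T) :: 'a)"
      using st assms by (intro koszul_sign_swap) auto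
    then show "?f t s = - ?f s t" using st by (simp add: insert_commute mult_ac)
  qed (use assms in auto)
  finally show ?thesis .
qed

section \<open>Set families whose exchanges span cubes\<close>

definition exchange_set :: "nat set set \<Rightarrow> nat set \<Rightarrow> nat set" where
  "exchange_set F C = {s\<in>C. C - {s} \<in> F}"

locale cubical_family =
  fixes N :: "nat set" and F :: "nat set set" and x y :: "nat \<Rightarrow> 'a::comm_ring_1"
  assumes finite_N: "finite N" and F_subset: "\<And>C. C \<in> F \<Longrightarrow> C \<subseteq> N"
    and cube: "\<And>C s t. C \<in> F \<Longrightarrow> s \<in> exchange_set F C \<Longrightarrow> t \<in> exchange_set F C \<Longrightarrow> s \<noteq> t \<Longrightarrow>
      C - {s} - {t} \<in> F"
begin

abbreviation "bdry \<equiv> cube_diff N x y"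

definition gen :: "nat set \<Rightarrow> 'a" where
  "gen C = (\<Prod>s\<in>C. y s) * (\<Prod>s\<in>N - C. x s)"

definition chains :: "nat set set \<Rightarrow> nat \<Rightarrow> (nat set \<Rightarrow> nat set \<Rightarrow> 'a) set" where
  "chains G i = {v. \<forall>C T. v C T \<noteq> 0 \<longrightarrow> C \<in> G \<and> T \<subseteq> exchange_set F C \<and> card T = i}"

lemma chainsD:
  assumes "v \<in> chains G i" "v C T \<noteq> 0"
  shows "C \<in> G" "T \<subseteq> exchange_set F C" "card T = i"
  using assms unfolding chains_def by blast+

lemma chains_add: "v \<in> chains G i \<Longrightarrow> w \<in> chains G i \<Longrightarrow> (\<lambda>C T. v C T + w C T) \<in> chains G i"
  unfolding chains_def by (smt (verit) add_0_left mem_Collect_eq)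

lemma chains_mono: "G \<subseteq> H \<Longrightarrow> chains G i \<subseteq> chains H i"
  unfolding chains_def by blast

lemma exchange_set_subset: "C \<in> F \<Longrightarrow> exchange_set F C \<subseteq> N"
  using F_subset by (auto simp: exchange_set_def)

text \<open>Makes the lower face \<open>(C - {s}, T - {s})\<close> a basis element again: the
  remaining directions stay exchangeable after one exchange.\<close>

lemma exchange_set_Diff:
  assumes "C \<in> F" "s \<in> exchange_set F C" "t \<in> exchange_set F C" "s \<noteq> t"
  shows "t \<in> exchange_set F (C - {s})"
  using assms cube[OF assms] by (auto simp: exchange_set_def)

text \<open>Passing from \<open>C\<close> to \<open>C - {s}\<close> lowers the size, so chains over
  an initial \<open>G\<close> form a subcomplex. The strict inequality leaves members of the top
  size free, so they can be peeled off one at a time.\<close>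

definition initial :: "nat set set \<Rightarrow> bool" where
  "initial G \<longleftrightarrow> G \<subseteq> F \<and> (\<forall>C\<in>G. \<forall>D\<in>F. card D < card C \<longrightarrow> D \<in> G)"

lemma diff_in_chains:
  assumes G: "initial G" and v: "v \<in> chains G (Suc i)"
  shows "bdry v \<in> chains G i"
  unfolding chains_def
proof (intro CollectI allI impI)
  fix C T assume "bdry v C T \<noteq> 0"
  then obtain s where s: "s \<in> N - T" "v (insert s C) (insert s T) \<noteq> 0"
    unfolding cube_diff_def by (metis (no_types, lifting) mult_zero_right sum.neutral)
  note vD = chainsD[OF v s(2)]
  have CF: "insert s C \<in> F" using vD(1) G unfolding initial_def by blast
  have fin: "finite T" "finite (insert s C)"
    using finite_subset[OF subset_trans[OF vD(2) exchange_set_subset[OF CF]] finite_N]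
      finite_subset[OF F_subset[OF CF] finite_N] by auto
  have "card T = i" using vD(3) fin(1) s(1) by simp
  moreover have "C \<in> G \<and> T \<subseteq> exchange_set F C"
  \<comment> \<open>The cases are the two faces: for \<open>s \<in> C\<close> the top vertex is
    unchanged, otherwise \<open>C\<close> arises from \<open>insert s C\<close> by exchanging
    \<open>s\<close>.\<close>
  proof (cases "s \<in> C")
    case True
    then show ?thesis using vD by (simp add: insert_absorb)
  next
    case False
    have sex: "s \<in> exchange_set F (insert s C)" using vD(2) by blast
    then have "C \<in> F" using False by (simp add: exchange_set_def)
    moreover have "card C < card (insert s C)" using False fin(2) by simp
    ultimately have "C \<in> G" using G vD(1) unfolding initial_def by blast
    moreover have "T \<subseteq> exchange_set F C"
    proof
      fix t assume "t \<in> T"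
      then have "t \<in> exchange_set F (insert s C - {s})"
        using exchange_set_Diff[OF CF sex, of t] vD(2) s(1) by blast
      then show "t \<in> exchange_set F C" using False by simp
    qed
    ultimately show ?thesis by blast
  qed
  ultimately show "C \<in> G \<and> T \<subseteq> exchange_set F C \<and> card T = i" by blast
qed

text \<open>The sum runs over all of \<open>Pow N\<close>, not just \<open>F\<close>, so that
  subsets can be paired by adding or removing \<open>s\<close>; chains vanish off \<open>F\<close>
  anyway.\<close>

definition aug :: "(nat set \<Rightarrow> nat set \<Rightarrow> 'a) \<Rightarrow> 'a" where
  "aug v = (\<Sum>C\<in>Pow N. gen C * v C {})"

text \<open>The linear syzygy along an edge of the cube.\<close>

lemma gen_insert:
  assumes "C \<subseteq> N" "s \<in> N" "s \<notin> C"
  shows "gen (insert s C) * x s = gen C * y s"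
proof -
  have "finite C" using assms(1) finite_N finite_subset by blast
  moreover have "(\<Prod>t\<in>N - C. x t) = x s * (\<Prod>t\<in>N - insert s C. x t)"
    using prod.remove[of "N - C" s x] assms finite_N by (simp add: Diff_insert[symmetric])
  ultimately show ?thesis using assms by (simp add: gen_def mult_ac)
qed

text \<open>For each direction \<open>s\<close> the subsets without \<open>s\<close> are paired with
  those containing it, and each pair cancels by \<open>gen_insert\<close>.\<close>

lemma aug_diff: "aug (bdry v) = 0"
proof -
  let ?f = "\<lambda>s C. gen C * (if s \<in> C then x s else - y s) * v (insert s C) {s}"
  have "aug (bdry v) = (\<Sum>s\<in>N. \<Sum>C\<in>Pow N. ?f s C)"
    unfolding aug_def cube_diff_def
    by (subst sum.swap) (simp add: sum_distrib_left koszul_sign_def mult.assoc)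
  also have "\<dots> = 0"
  proof (rule sum.neutral, rule ballI)
    fix s assume s: "s \<in> N"
    have "Pow N = Pow (N - {s}) \<union> insert s ` Pow (N - {s})"
      using Pow_insert[of s "N - {s}"] s by (simp add: insert_absorb)
    then have "(\<Sum>C\<in>Pow N. ?f s C) =
      (\<Sum>C\<in>Pow (N - {s}). ?f s C) + (\<Sum>C\<in>insert s ` Pow (N - {s}). ?f s C)"
      using finite_N by (simp only:) (rule sum.union_disjoint, auto)
    also have "(\<Sum>C\<in>insert s ` Pow (N - {s}). ?f s C) = (\<Sum>C\<in>Pow (N - {s}). ?f s (insert s C))"
      by (subst sum.reindex) (auto simp: inj_on_def)
    also have "(\<Sum>C\<in>Pow (N - {s}). ?f s C) + \<dots> = 0"
      unfolding sum.distrib[symmetric]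
    proof (rule sum.neutral, rule ballI)
      fix C assume "C \<in> Pow (N - {s})"
      then have C: "C \<subseteq> N" "s \<notin> C" by auto
      show "?f s C + ?f s (insert s C) = 0"
        using C gen_insert[OF C(1) s C(2)] by simp
    qed
    finally show "(\<Sum>C\<in>Pow N. ?f s C) = 0" .
  qed
  finally show ?thesis .
qed

end

text \<open>The two algebraic inputs: the \<open>x s\<close> form a regular sequence in any order,
  and a colon ideal by \<open>gen C\<close> is contained in the ideal of the exchangeable variables.
  The family \<open>G\<close> need only avoid supersets of \<open>C\<close>, which peeling by size
  guarantees.\<close>

locale regular_cubical_family = cubical_family +
  assumes regular: "\<And>V s w. V \<subseteq> N \<Longrightarrow> s \<in> N - V \<Longrightarrow> \<exists>b. x s * w = (\<Sum>t\<in>V. x t * b t) \<Longrightarrow>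
      \<exists>b. w = (\<Sum>t\<in>V. x t * b t)"
    and linear_quotients: "\<And>C G a c. C \<in> F \<Longrightarrow> G \<subseteq> F \<Longrightarrow> (\<And>D. D \<in> G \<Longrightarrow> \<not> C \<subseteq> D) \<Longrightarrow>
      gen C * a = (\<Sum>D\<in>G. gen D * c D) \<Longrightarrow> \<exists>b. a = (\<Sum>s\<in>exchange_set F C. x s * b s)"
begin

text \<open>Peeling off the largest member \<open>C\<close> of the family leaves, in the coordinates at \<open>C\<close>, a cycle
  of the Koszul complex on \<open>exchange_set F C\<close>.\<close>

lemma initial_exact:
  assumes "initial G"
    and "v \<in> chains G i" "i > 0 \<Longrightarrow> bdry v = (\<lambda>C T. 0)" "i = 0 \<Longrightarrow> aug v = 0"
  shows "\<exists>w\<in>chains G (Suc i). bdry w = v"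
proof -
  have "finite F" using finite_subset[of F "Pow N"] finite_N F_subset by auto
  then have "finite G" using assms(1) finite_subset unfolding initial_def by blast
  then show ?thesis using assms
  proof (induction G arbitrary: v rule: finite_ranking_induct[where f = card])
    case empty
    then have "v = (\<lambda>C T. 0)" by (auto simp: chains_def)
    then show ?case
      by (intro bexI[of _ "\<lambda>C T. 0"]) (auto simp: chains_def cube_diff_def fun_eq_iff)
  next
    case (insert C G)
    show ?case
    proof (cases "C \<in> G")
      case True
      then show ?thesis using insert.IH insert.prems by (simp add: insert_absorb)
    next
      case CG: False
      have CF: "C \<in> F" and GF: "G \<subseteq> F" using insert.prems(1) by (auto simp: initial_def)
      have CN: "C \<subseteq> N" using CF F_subset by blast
      have initG: "initial G" unfolding initial_def
      proof (intro conjI GF ballI impI)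
        fix B D assume BD: "B \<in> G" "D \<in> F" "card D < card B"
        then have "D \<in> insert C G" using insert.prems(1) unfolding initial_def by blast
        then show "D \<in> G" using BD insert.hyps(2)[of B] by auto
      qed
      have not_le: "\<not> C \<subseteq> D" if "D \<in> G" for D
      proof
        assume "C \<subseteq> D"
        moreover have "finite D" using that GF F_subset finite_N finite_subset by blast
        ultimately show False
          using card_seteq[of D C] insert.hyps(2)[OF that] that CG by auto
      qed
      have not_insert: "insert s C \<notin> insert C G" if "s \<notin> C" for s
        using that not_le[of "insert s C"] by auto
      \<comment> \<open>For \<open>s \<notin> C\<close> both sides vanish: \<open>insert s C\<close>
        is outside the remaining family, and \<open>insert s T\<close> is not a subset of
        \<open>C\<close>. Hence no \<open>y\<close> survives and the boundary at \<open>C\<close> is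
        a Koszul differential.\<close>
      have diff_at_C: "bdry w C T = koszul_diff N x (w C) T" if "w \<in> chains (insert C G) j" for w j T
        unfolding cube_diff_def koszul_diff_def
      proof (rule sum.cong)
        fix s
        have "s \<notin> C \<Longrightarrow> w (insert s C) (insert s T) = 0 \<and> w C (insert s T) = 0"
          using chainsD(1)[OF that, of "insert s C"] chainsD(2)[OF that, of C "insert s T"]
            not_insert[of s] by (auto simp: exchange_set_def)
        then show "koszul_sign s T * (if s \<in> C then x s else - y s) *
          w (insert s C) (insert s T) = koszul_sign s T * x s * w C (insert s T)"
          by (auto simp: insert_absorb)
      qed simp
      have "\<exists>b. (\<forall>T. b T \<noteq> 0 \<longrightarrow> T \<subseteq> exchange_set F C \<and> card T = Suc i) \<and> koszul_diff N x b = v C"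
      proof (rule koszul_exact[OF finite_N exchange_set_subset[OF CF] regular])
        show "T \<subseteq> exchange_set F C \<and> card T = i" if "v C T \<noteq> 0" for T
          using chainsD[OF insert.prems(2) that] by blast
        show "koszul_diff N x (v C) = (\<lambda>T. 0)" if "i > 0"
          using insert.prems(3)[OF that] diff_at_C[OF insert.prems(2)] by (simp add: fun_eq_iff)
        show "\<exists>b. v C {} = (\<Sum>t\<in>exchange_set F C. x t * b t)" if "i = 0"
        proof (rule linear_quotients[OF CF GF not_le])
          \<comment> \<open>Splitting off the term at \<open>C\<close> writes
            \<open>gen C * v C {}\<close> as a combination of the smaller generators, which puts
            \<open>v C {}\<close> into the colon ideal.\<close>
          have "0 = (\<Sum>D\<in>insert C G. gen D * v D {})"
            unfolding insert.prems(4)[OF that, symmetric] aug_def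
          proof (rule sum.mono_neutral_right)
            show "insert C G \<subseteq> Pow N" using CN GF F_subset by blast
            show "\<forall>D\<in>Pow N - insert C G. gen D * v D {} = 0"
              using chainsD(1)[OF insert.prems(2)] by (metis DiffD2 mult_zero_right)
          qed (use finite_N in simp)
          then show "gen C * v C {} = (\<Sum>D\<in>G. gen D * - v D {})"
            using insert.hyps(1) CG by (simp add: sum_negf eq_neg_iff_add_eq_0)
        qed
      qed
      then obtain b where b: "\<And>T. b T \<noteq> 0 \<Longrightarrow> T \<subseteq> exchange_set F C \<and> card T = Suc i"
        "koszul_diff N x b = v C" by blast
      define w1 where "w1 = (\<lambda>D T. if D = C then b T else 0)"
      have w1: "w1 \<in> chains (insert C G) (Suc i)"
        using b(1) by (auto simp: w1_def chains_def)
      note dw1 = diff_in_chains[OF insert.prems(1) w1]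
      define v' where "v' = (\<lambda>D T. v D T + - bdry w1 D T)"
      have "(\<lambda>D T. - bdry w1 D T) \<in> chains (insert C G) i" using dw1 by (auto simp: chains_def)
      then have v'_chain: "v' \<in> chains (insert C G) i"
        unfolding v'_def by (rule chains_add[OF insert.prems(2)])
      have "v' C T = 0" for T
        using b(2) diff_at_C[OF w1, of T] by (simp add: v'_def w1_def)
      then have v': "v' \<in> chains G i" using v'_chain unfolding chains_def by blast
      have "bdry v' D T = 0" if "i > 0" for D T
      proof (cases "finite T")
        case True
        have "bdry v' D T = bdry v D T - bdry (bdry w1) D T"
          by (simp add: v'_def cube_diff_def[of _ _ _ _ D T] algebra_simps sum_subtractf)
        then show ?thesis
          using insert.prems(3)[OF that] cube_diff_cube_diff[OF finite_N True] by simp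
      next
        case False
        \<comment> \<open>An infinite set has \<open>card\<close> 0, which the degree
          \<open>i > 0\<close> excludes.\<close>
        have "v' E (insert s T) = 0" for E s
        proof (rule ccontr)
          assume "v' E (insert s T) \<noteq> 0"
          then show False
            using chainsD(3)[OF v', of E "insert s T"] False that by simp
        qed
        then show ?thesis by (simp add: cube_diff_def)
      qed
      moreover have "aug v' = 0" if "i = 0"
      proof -
        have "aug v' = aug v - aug (bdry w1)"
          by (simp add: v'_def aug_def algebra_simps sum_subtractf)
        then show ?thesis using insert.prems(4)[OF that] by (simp add: aug_diff)
      qed
      ultimately obtain w2 where w2: "w2 \<in> chains G (Suc i)" "bdry w2 = v'"
        using insert.IH[OF initG v'] by blast
      have "(\<lambda>D T. w1 D T + w2 D T) \<in> chains (insert C G) (Suc i)"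
        using chains_add[OF w1] chains_mono[of G "insert C G"] w2(1) by blast
      moreover have "bdry (\<lambda>D T. w1 D T + w2 D T) D T = v D T" for D T
      proof -
        have "bdry (\<lambda>D T. w1 D T + w2 D T) D T = bdry w1 D T + bdry w2 D T"
          by (simp add: cube_diff_def algebra_simps sum.distrib)
        then show ?thesis by (simp add: w2(2) v'_def)
      qed
      ultimately show ?thesis by blast
    qed
  qed
qed

lemma initial_F: "initial F"
  by (auto simp: initial_def)

lemmas exact = initial_exact[OF initial_F]

end

section \<open>Projective resolutions given by matrices\<close>

lemma resolutionD:
  assumes "resolution I r P A"
  shows "P i \<subseteq> carrier_vec (r i)"
    and "A 0 \<in> carrier_mat 1 (r 0)"
    and "A (Suc i) \<in> carrier_mat (r i) (r (Suc i))"
    and "v \<in> P (Suc i) \<Longrightarrow> A (Suc i) *\<^sub>v v \<in> P i"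
    and "v \<in> P i \<Longrightarrow> A i *\<^sub>v v = 0\<^sub>v (dim_row (A i)) \<Longrightarrow> \<exists>w\<in>P (Suc i). A (Suc i) *\<^sub>v w = v"
    and "v \<in> P (Suc i) \<Longrightarrow> A i *\<^sub>v (A (Suc i) *\<^sub>v v) = 0\<^sub>v (dim_row (A i))"
    and "(\<lambda>v. A 0 *\<^sub>v v) ` P 0 = {vec 1 (\<lambda>_. f) | f. f \<in> I}"
proof -
  have ex: "(\<lambda>v. A (Suc i) *\<^sub>v v) ` P (Suc i) = {v \<in> P i. A i *\<^sub>v v = 0\<^sub>v (dim_row (A i))}"
    using assms unfolding resolution_def by blast
  show "v \<in> P (Suc i) \<Longrightarrow> A (Suc i) *\<^sub>v v \<in> P i"
    "v \<in> P (Suc i) \<Longrightarrow> A i *\<^sub>v (A (Suc i) *\<^sub>v v) = 0\<^sub>v (dim_row (A i))"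
    using ex by blast+
  show "\<exists>w\<in>P (Suc i). A (Suc i) *\<^sub>v w = v" if "v \<in> P i" "A i *\<^sub>v v = 0\<^sub>v (dim_row (A i))"
  proof -
    have "v \<in> (\<lambda>v. A (Suc i) *\<^sub>v v) ` P (Suc i)" unfolding ex using that by simp
    then show ?thesis by (metis imageE)
  qed
  show "P i \<subseteq> carrier_vec (r i)" "A 0 \<in> carrier_mat 1 (r 0)"
    "A (Suc i) \<in> carrier_mat (r i) (r (Suc i))"
    "(\<lambda>v. A 0 *\<^sub>v v) ` P 0 = {vec 1 (\<lambda>_. f) | f. f \<in> I}"
    using assms unfolding resolution_def by blast+
qed

definition idempotent_mat :: "nat \<Rightarrow> 'a::comm_ring_1 mat \<Rightarrow> bool" where
  "idempotent_mat r e \<longleftrightarrow> e \<in> carrier_mat r r \<and> e * e = e"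

abbreviation mat_image :: "nat \<Rightarrow> 'a::comm_ring_1 mat \<Rightarrow> 'a vec set" where
  "mat_image r e \<equiv> (\<lambda>v. e *\<^sub>v v) ` carrier_vec r"

lemma mult_mat_image:
  assumes "idempotent_mat r e" "v \<in> mat_image r e"
  shows "e *\<^sub>v v = v" "v \<in> carrier_vec r"
proof -
  obtain u where u: "u \<in> carrier_vec r" "v = e *\<^sub>v u" using assms(2) by blast
  have e: "e \<in> carrier_mat r r" "e * e = e" using assms(1) by (auto simp: idempotent_mat_def)
  show "e *\<^sub>v v = v" using u(2) e(2) assoc_mult_mat_vec[OF e(1) e(1) u(1)] by metis
  show "v \<in> carrier_vec r" using u e by auto
qed

lemma idempotent_one_mat: "idempotent_mat r (1\<^sub>m r)"
  by (simp add: idempotent_mat_def)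

lemma mat_image_one: "mat_image r (1\<^sub>m r) = carrier_vec r"
  by (auto simp: image_iff)

lemma projective_summand_iff: "projective_summand r P \<longleftrightarrow> (\<exists>e. idempotent_mat r e \<and> P = mat_image r e)"
  by (auto simp: projective_summand_def idempotent_mat_def)

text \<open>Projectivity in matrix form: a preimage is chosen for each column of \<open>e\<close>.
  Only values on the image of \<open>e\<close> are controlled, hence \<open>B * e\<close> on the
  right; \<open>e' * H = H\<close> records that \<open>H\<close> maps into the image of
  \<open>e'\<close>.\<close>

lemma lift_mat:
  assumes e: "idempotent_mat r e" and e': "idempotent_mat r' e'"
    and B: "B \<in> carrier_mat m r" and M: "M \<in> carrier_mat m r'"
    and ex: "\<And>v. v \<in> mat_image r e \<Longrightarrow> \<exists>w\<in>mat_image r' e'. M *\<^sub>v w = B *\<^sub>v v"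
  shows "\<exists>H\<in>carrier_mat r' r. e' * H = H \<and> M * H = B * e"
proof -
  have ec: "e \<in> carrier_mat r r" and ec': "e' \<in> carrier_mat r' r'"
    using e e' by (auto simp: idempotent_mat_def)
  have "\<exists>w\<in>mat_image r' e'. M *\<^sub>v w = B *\<^sub>v col e q" if "q < r" for q
  proof (rule ex)
    have "e *\<^sub>v col e q = col e q"
      using col_mult2[OF ec ec that] e unfolding idempotent_mat_def by metis
    then show "col e q \<in> mat_image r e" using ec that by (metis col_dim carrier_matD(1) imageI)
  qed
  then obtain w where w: "\<And>q. q < r \<Longrightarrow> w q \<in> mat_image r' e' \<and> M *\<^sub>v w q = B *\<^sub>v col e q"
    by metis
  define H where "H = mat_of_cols r' (map w [0..<r])"
  have H: "H \<in> carrier_mat r' r"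
    unfolding H_def using mat_of_cols_carrier(1)[of r' "map w [0..<r]"] by simp
  have colH: "col H q = w q" if "q < r" for q
    using that mult_mat_image(2)[OF e', of "w q"] w[OF that] by (simp add: H_def)
  have "e' * H = H"
  proof (rule mat_col_eqI)
    fix q assume "q < dim_col H"
    then have q: "q < r" using H by simp
    show "col (e' * H) q = col H q"
      using col_mult2[OF ec' H q] colH[OF q] mult_mat_image(1)[OF e', of "w q"] w[OF q] by metis
  qed (use H ec' in auto)
  moreover have "M * H = B * e"
  proof (rule mat_col_eqI)
    fix q assume "q < dim_col (B * e)"
    then have q: "q < r" using ec by simp
    show "col (M * H) q = col (B * e) q"
      using col_mult2[OF M H q] col_mult2[OF B ec q] colH[OF q] w[OF q] by simp
  qed (use H ec B M in auto)
  ultimately show ?thesis using H by blast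
qed

lemma comparison_map:
  assumes R: "resolution I r (\<lambda>i. mat_image (r i) (e i)) A"
    and e: "\<And>i. idempotent_mat (r i) (e i)"
    and R': "resolution I r' (\<lambda>i. mat_image (r' i) (e' i)) A'"
    and e': "\<And>i. idempotent_mat (r' i) (e' i)"
  obtains f where "\<And>i. f i \<in> carrier_mat (r' i) (r i)" "\<And>i. e' i * f i = f i"
    "A' 0 * f 0 = A 0 * e 0" "\<And>i. A' (Suc i) * f (Suc i) = f i * A (Suc i) * e (Suc i)"
proof -
  let ?P = "\<lambda>i. mat_image (r i) (e i)" and ?P' = "\<lambda>i. mat_image (r' i) (e' i)"
  have ec: "e i \<in> carrier_mat (r i) (r i)" and ec': "e' i \<in> carrier_mat (r' i) (r' i)" for i
    using e e' by (auto simp: idempotent_mat_def)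
  note A0 = resolutionD(2)[OF R] and A'0 = resolutionD(2)[OF R']
  note AS = resolutionD(3)[OF R] and A'S = resolutionD(3)[OF R']
  \<comment> \<open>The last clause, that cycles go to cycles, is what makes the next lift possible.
    Stating it for every \<open>n\<close> lets the augmentation and the later differentials share
    one induction step.\<close>
  define good where "good n x \<longleftrightarrow> x \<in> carrier_mat (r' n) (r n) \<and> e' n * x = x \<and>
    (n = 0 \<longrightarrow> A' 0 * x = A 0 * e 0) \<and>
    (\<forall>v\<in>?P n. A n *\<^sub>v v = 0\<^sub>v (dim_row (A n)) \<longrightarrow> A' n *\<^sub>v (x *\<^sub>v v) = 0\<^sub>v (dim_row (A' n)))"
    for n x
  have "\<exists>f. \<forall>n. good n (f n) \<and> A' (Suc n) * f (Suc n) = f n * A (Suc n) * e (Suc n)"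
  proof (rule dependent_nat_choice)
    have "\<exists>w\<in>?P' 0. A' 0 *\<^sub>v w = A 0 *\<^sub>v v" if v: "v \<in> ?P 0" for v
    proof -
      have "A 0 *\<^sub>v v \<in> (\<lambda>v. A' 0 *\<^sub>v v) ` ?P' 0"
        unfolding resolutionD(7)[OF R'] resolutionD(7)[OF R, symmetric] using v by blast
      then show ?thesis by (metis imageE)
    qed
    from lift_mat[OF e e' A0 A'0 this]
    obtain H where H: "H \<in> carrier_mat (r' 0) (r 0)" "e' 0 * H = H" "A' 0 * H = A 0 * e 0"
      by blast
    have "A' 0 *\<^sub>v (H *\<^sub>v v) = 0\<^sub>v (dim_row (A' 0))"
      if v: "v \<in> ?P 0" "A 0 *\<^sub>v v = 0\<^sub>v (dim_row (A 0))" for v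
    proof -
      note vv = mult_mat_image[OF e v(1)]
      have "A' 0 *\<^sub>v (H *\<^sub>v v) = (A 0 * e 0) *\<^sub>v v"
        using assoc_mult_mat_vec[OF A'0 H(1) vv(2)] H(3) by simp
      also have "\<dots> = A 0 *\<^sub>v v" using assoc_mult_mat_vec[OF A0 ec vv(2)] vv(1) by simp
      finally show ?thesis using v(2) A0 A'0 by simp
    qed
    then show "\<exists>x. good 0 x" using H unfolding good_def by blast
  next
    fix x n assume x: "good n x"
    have xc: "x \<in> carrier_mat (r' n) (r n)" using x by (simp add: good_def)
    have xk: "\<forall>v\<in>?P n. A n *\<^sub>v v = 0\<^sub>v (dim_row (A n)) \<longrightarrow>
      A' n *\<^sub>v (x *\<^sub>v v) = 0\<^sub>v (dim_row (A' n))"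
      using x unfolding good_def by blast
    have xA: "x * A (Suc n) \<in> carrier_mat (r' n) (r (Suc n))" using xc AS by auto
    have "\<exists>w\<in>?P' (Suc n). A' (Suc n) *\<^sub>v w = (x * A (Suc n)) *\<^sub>v v" if v: "v \<in> ?P (Suc n)" for v
    proof -
      note vc = mult_mat_image(2)[OF e v]
      have Av: "A (Suc n) *\<^sub>v v \<in> ?P n" by (rule resolutionD(4)[OF R v])
      have Avc: "A (Suc n) *\<^sub>v v \<in> carrier_vec (r n)" by (rule mult_mat_image(2)[OF e Av])
      have eq: "(x * A (Suc n)) *\<^sub>v v = x *\<^sub>v (A (Suc n) *\<^sub>v v)"
        by (rule assoc_mult_mat_vec[OF xc AS vc])
      have "x *\<^sub>v (A (Suc n) *\<^sub>v v) = e' n *\<^sub>v (x *\<^sub>v (A (Suc n) *\<^sub>v v))"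
        using assoc_mult_mat_vec[OF ec' xc Avc] x unfolding good_def by metis
      then have "(x * A (Suc n)) *\<^sub>v v \<in> ?P' n"
        unfolding eq using xc Avc by (metis imageI mult_mat_vec_carrier)
      moreover have "A' n *\<^sub>v ((x * A (Suc n)) *\<^sub>v v) = 0\<^sub>v (dim_row (A' n))"
        unfolding eq using bspec[OF xk Av] resolutionD(6)[OF R v] by (rule mp)
      ultimately show ?thesis by (rule resolutionD(5)[OF R'])
    qed
    from lift_mat[OF e e' xA A'S this]
    obtain H where H: "H \<in> carrier_mat (r' (Suc n)) (r (Suc n))" "e' (Suc n) * H = H"
      "A' (Suc n) * H = x * A (Suc n) * e (Suc n)"
      by blast
    have "A' (Suc n) *\<^sub>v (H *\<^sub>v v) = 0\<^sub>v (dim_row (A' (Suc n)))"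
      if v: "v \<in> ?P (Suc n)" "A (Suc n) *\<^sub>v v = 0\<^sub>v (dim_row (A (Suc n)))" for v
    proof -
      note vv = mult_mat_image[OF e v(1)]
      have "A' (Suc n) *\<^sub>v (H *\<^sub>v v) = (x * A (Suc n) * e (Suc n)) *\<^sub>v v"
        using assoc_mult_mat_vec[OF A'S H(1) vv(2)] H(3) by simp
      also have "\<dots> = x *\<^sub>v (A (Suc n) *\<^sub>v v)"
        using assoc_mult_mat_vec[OF xA ec vv(2)] vv(1) assoc_mult_mat_vec[OF xc AS vv(2)] by simp
      also have "\<dots> = 0\<^sub>v (r' n)"
        using v(2) AS[of n] xc by (auto intro!: eq_vecI)
      finally show ?thesis using A'S[of n] by simp
    qed
    then show "\<exists>y. good (Suc n) y \<and> A' (Suc n) * y = x * A (Suc n) * e (Suc n)"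
      using H unfolding good_def by blast
  qed
  then show thesis using that unfolding good_def by metis
qed

section \<open>Homotopies and the rigidity of minimal resolutions\<close>

lemma zero_mat_mult_vec:
  "v \<in> carrier_vec k \<Longrightarrow> 0\<^sub>m n k *\<^sub>v v = (0\<^sub>v n :: 'a::semiring_0 vec)"
  by (intro eq_vecI) auto

lemma free_lift:
  assumes R: "resolution I r (\<lambda>i. carrier_vec (r i)) A"
    and M: "M \<in> carrier_mat (r i) k" and AM: "A i * M = 0\<^sub>m (dim_row (A i)) k"
  shows "\<exists>N\<in>carrier_mat (r (Suc i)) k. A (Suc i) * N = M"
proof -
  note AS = resolutionD(3)[OF R]
  have Ai: "A i \<in> carrier_mat (dim_row (A i)) (r i)"
    using resolutionD(2)[OF R] AS by (cases i) auto
  have "\<exists>w\<in>mat_image (r (Suc i)) (1\<^sub>m (r (Suc i))). A (Suc i) *\<^sub>v w = M *\<^sub>v v"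
    if "v \<in> mat_image k (1\<^sub>m k)" for v
  proof -
    have v: "v \<in> carrier_vec k" using that by (simp add: mat_image_one)
    have "A i *\<^sub>v (M *\<^sub>v v) = 0\<^sub>v (dim_row (A i))"
      using assoc_mult_mat_vec[OF Ai M v] AM zero_mat_mult_vec[OF v] by simp
    then show ?thesis
      using resolutionD(5)[OF R, of "M *\<^sub>v v" i] M v by (simp add: mat_image_one)
  qed
  from lift_mat[OF idempotent_one_mat idempotent_one_mat M AS this]
  show ?thesis using M by auto
qed

lemma resolution_mult_eq_0:
  assumes R: "resolution I r (\<lambda>i. carrier_vec (r i)) A"
  shows "A i * A (Suc i) = 0\<^sub>m (dim_row (A i)) (r (Suc i))"
proof (rule mat_col_eqI)
  note AS = resolutionD(3)[OF R]
  have Ai: "A i \<in> carrier_mat (dim_row (A i)) (r i)"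
    using resolutionD(2)[OF R] AS by (cases i) auto
  fix q assume "q < dim_col (0\<^sub>m (dim_row (A i)) (r (Suc i)) :: 'a mat)"
  then have q: "q < r (Suc i)" by simp
  have "A i *\<^sub>v (A (Suc i) *\<^sub>v col (1\<^sub>m (r (Suc i))) q) = 0\<^sub>v (dim_row (A i))"
    by (rule resolutionD(6)[OF R]) (use q in simp)
  moreover have "A (Suc i) *\<^sub>v col (1\<^sub>m (r (Suc i))) q = col (A (Suc i)) q"
    using col_mult2[OF AS one_carrier_mat q] AS[of i] by simp
  moreover have "col (0\<^sub>m (dim_row (A i)) (r (Suc i))) q = (0\<^sub>v (dim_row (A i)) :: 'a vec)"
    using q by (intro eq_vecI) auto
  ultimately show "col (A i * A (Suc i)) q = col (0\<^sub>m (dim_row (A i)) (r (Suc i))) q"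
    using col_mult2[OF Ai AS q] by metis
qed (use resolutionD(3)[OF R] in auto)

text \<open>An endomorphism lifting the zero map of \<open>I\<close> is homotopic to zero; each
  \<open>h\<close> is a lift along a differential, obtained from \<open>free_lift\<close>.\<close>

lemma null_homotopy:
  assumes R: "resolution I r (\<lambda>i. carrier_vec (r i)) A"
    and \<psi>: "\<And>i. \<psi> i \<in> carrier_mat (r i) (r i)"
    and \<psi>0: "A 0 * \<psi> 0 = 0\<^sub>m 1 (r 0)"
    and \<psi>S: "\<And>i. A (Suc i) * \<psi> (Suc i) = \<psi> i * A (Suc i)"
  obtains h where "\<And>i. h i \<in> carrier_mat (r (Suc i)) (r i)" "\<psi> 0 = A 1 * h 0"
    "\<And>i. \<psi> (Suc i) = A (Suc (Suc i)) * h (Suc i) + h i * A (Suc i)"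
proof -
  note A0 = resolutionD(2)[OF R] and AS = resolutionD(3)[OF R]
  \<comment> \<open>Together with \<open>\<psi>S\<close>, the last clause says that
    \<open>\<psi> (Suc n) - x * A (Suc n)\<close> is killed by \<open>A (Suc n)\<close>, so the next
    component of the homotopy exists.\<close>
  define good where "good n x \<longleftrightarrow> x \<in> carrier_mat (r (Suc n)) (r n) \<and>
    (n = 0 \<longrightarrow> \<psi> 0 = A 1 * x) \<and> A (Suc n) * x * A (Suc n) = \<psi> n * A (Suc n)" for n x
  have "\<exists>h. \<forall>n. good n (h n) \<and>
    \<psi> (Suc n) = A (Suc (Suc n)) * h (Suc n) + h n * A (Suc n)"
  proof (rule dependent_nat_choice)
    have "\<exists>N\<in>carrier_mat (r (Suc 0)) (r 0). A (Suc 0) * N = \<psi> 0"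
      using free_lift[OF R \<psi>, of 0] \<psi>0 A0 by simp
    then show "\<exists>x. good 0 x" unfolding good_def by auto
  next
    fix x n assume x: "good n x"
    then have xc: "x \<in> carrier_mat (r (Suc n)) (r n)" by (simp add: good_def)
    have xA: "x * A (Suc n) \<in> carrier_mat (r (Suc n)) (r (Suc n))" using xc AS by auto
    let ?M = "\<psi> (Suc n) - x * A (Suc n)"
    have M: "?M \<in> carrier_mat (r (Suc n)) (r (Suc n))" using xA \<psi> by (simp add: minus_carrier_mat)
    have "A (Suc n) * ?M = A (Suc n) * \<psi> (Suc n) - A (Suc n) * (x * A (Suc n))"
      by (rule mult_minus_distrib_mat[OF AS \<psi> xA])
    also have "A (Suc n) * (x * A (Suc n)) = \<psi> n * A (Suc n)"
      using x assoc_mult_mat[OF AS xc AS] by (simp add: good_def)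
    finally have "A (Suc n) * ?M = 0\<^sub>m (dim_row (A (Suc n))) (r (Suc n))"
      using \<psi>S AS[of n] \<psi>[of n] by (auto intro!: eq_matI)
    then obtain N where N: "N \<in> carrier_mat (r (Suc (Suc n))) (r (Suc n))" "A (Suc (Suc n)) * N = ?M"
      using free_lift[OF R M] by blast
    have eq: "\<psi> (Suc n) = A (Suc (Suc n)) * N + x * A (Suc n)"
      unfolding N(2) using \<psi>[of "Suc n"] xA by (auto intro!: eq_matI)
    have "A (Suc (Suc n)) * N * A (Suc (Suc n)) =
      \<psi> (Suc n) * A (Suc (Suc n)) - x * A (Suc n) * A (Suc (Suc n))"
      unfolding N(2) by (rule minus_mult_distrib_mat[OF \<psi> xA AS])
    also have "x * A (Suc n) * A (Suc (Suc n)) = 0\<^sub>m (r (Suc n)) (r (Suc (Suc n)))"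
      using assoc_mult_mat[OF xc AS AS] resolution_mult_eq_0[OF R, of "Suc n"] AS[of n] xc
      by simp
    finally have "A (Suc (Suc n)) * N * A (Suc (Suc n)) = \<psi> (Suc n) * A (Suc (Suc n))"
      using \<psi>[of "Suc n"] AS[of "Suc n"] by (auto intro!: eq_matI)
    then show "\<exists>y. good (Suc n) y \<and> \<psi> (Suc n) = A (Suc (Suc n)) * y + x * A (Suc n)"
      using N eq unfolding good_def by blast
  qed
  then show thesis using that unfolding good_def by metis
qed

lemma map_mat_mult_eq_0:
  assumes "comm_ring_hom \<epsilon>" "M \<in> carrier_mat a b" "N \<in> carrier_mat b c"
    and "map_mat \<epsilon> M = 0\<^sub>m a b \<or> map_mat \<epsilon> N = 0\<^sub>m b c"
  shows "map_mat \<epsilon> (M * N) = 0\<^sub>m a c"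
proof -
  interpret comm_ring_hom \<epsilon> by fact
  show ?thesis using assms(2-) mat_hom_mult[OF assms(2,3)] by auto
qed

text \<open>The ring homomorphism \<open>\<epsilon>\<close> plays the role of reduction modulo the maximal ideal; its vanishing
  on the differentials expresses minimality.\<close>

lemma minimal_endomorphism:
  fixes \<epsilon> :: "'a::comm_ring_1 \<Rightarrow> 'b::comm_ring_1"
  assumes R: "resolution I r (\<lambda>i. carrier_vec (r i)) A"
    and hom: "comm_ring_hom \<epsilon>"
    and min: "\<And>i. map_mat \<epsilon> (A (Suc i)) = 0\<^sub>m (r i) (r (Suc i))"
    and \<phi>: "\<And>i. \<phi> i \<in> carrier_mat (r i) (r i)"
    and \<phi>0: "A 0 * \<phi> 0 = A 0"
    and \<phi>S: "\<And>i. A (Suc i) * \<phi> (Suc i) = \<phi> i * A (Suc i)"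
  shows "map_mat \<epsilon> (\<phi> i) = 1\<^sub>m (r i)"
proof -
  interpret comm_ring_hom \<epsilon> by fact
  note A0 = resolutionD(2)[OF R] and AS = resolutionD(3)[OF R]
  define \<psi> where "\<psi> i = \<phi> i - 1\<^sub>m (r i)" for i
  have \<psi>: "\<psi> i \<in> carrier_mat (r i) (r i)" for i
    by (simp add: \<psi>_def minus_carrier_mat)
  have "A 0 * \<psi> 0 = 0\<^sub>m 1 (r 0)"
    unfolding \<psi>_def using mult_minus_distrib_mat[OF A0 \<phi> one_carrier_mat] \<phi>0 A0 by auto
  moreover have "A (Suc i) * \<psi> (Suc i) = \<psi> i * A (Suc i)" for i
  proof -
    have "A (Suc i) * \<psi> (Suc i) = A (Suc i) * \<phi> (Suc i) - A (Suc i)"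
      unfolding \<psi>_def using mult_minus_distrib_mat[OF AS \<phi> one_carrier_mat] AS[of i] by simp
    moreover have "\<psi> i * A (Suc i) = \<phi> i * A (Suc i) - A (Suc i)"
      unfolding \<psi>_def using minus_mult_distrib_mat[OF \<phi> one_carrier_mat AS] AS[of i] by simp
    ultimately show ?thesis using \<phi>S by simp
  qed
  ultimately obtain h where h: "\<And>i. h i \<in> carrier_mat (r (Suc i)) (r i)" "\<psi> 0 = A 1 * h 0"
    "\<And>i. \<psi> (Suc i) = A (Suc (Suc i)) * h (Suc i) + h i * A (Suc i)"
    using null_homotopy[OF R \<psi>] by blast
  \<comment> \<open>Every summand in the homotopy formula has a differential as a factor, and
    \<open>\<epsilon>\<close> annihilates differentials.\<close>
  have \<psi>0: "map_mat \<epsilon> (\<psi> i) = 0\<^sub>m (r i) (r i)"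
  proof (cases i)
    case 0
    then show ?thesis using h(2) map_mat_mult_eq_0[OF hom AS h(1), of 0] min by simp
  next
    case (Suc j)
    have "map_mat \<epsilon> (A (Suc (Suc j)) * h (Suc j)) = 0\<^sub>m (r (Suc j)) (r (Suc j))"
      "map_mat \<epsilon> (h j * A (Suc j)) = 0\<^sub>m (r (Suc j)) (r (Suc j))"
      using map_mat_mult_eq_0[OF hom AS h(1)] map_mat_mult_eq_0[OF hom h(1) AS] min by blast+
    moreover have "A (Suc (Suc j)) * h (Suc j) \<in> carrier_mat (r (Suc j)) (r (Suc j))"
      "h j * A (Suc j) \<in> carrier_mat (r (Suc j)) (r (Suc j))"
      using AS h(1) by (auto intro: mult_carrier_mat)
    moreover have "map_mat \<epsilon> (U + W) = map_mat \<epsilon> U + map_mat \<epsilon> W"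
      if "(U :: 'a mat) \<in> carrier_mat a b" "W \<in> carrier_mat a b" for U W a b
      using that by (intro eq_matI) (auto simp: hom_add)
    ultimately show ?thesis unfolding Suc h(3) by simp
  qed
  show ?thesis
  proof (rule eq_matI)
    fix p q assume pq: "p < dim_row (1\<^sub>m (r i) :: 'b mat)" "q < dim_col (1\<^sub>m (r i) :: 'b mat)"
    have "map_mat \<epsilon> (\<psi> i) $$ (p, q) = 0" using \<psi>0 pq by simp
    then have "\<epsilon> (\<phi> i $$ (p, q)) = \<epsilon> (1\<^sub>m (r i) $$ (p, q))"
      using pq \<phi>[of i] by (simp add: \<psi>_def hom_minus)
    then show "map_mat \<epsilon> (\<phi> i) $$ (p, q) = 1\<^sub>m (r i) $$ (p, q)"
      using pq \<phi>[of i] by auto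
  qed (use \<phi>[of i] in auto)
qed

text \<open>Comparison maps in both directions compose to a lift of the identity, which reduces to
  the identity matrix. In degree \<open>l\<close> this composite factors through
  \<open>P' l = 0\<close>, so the identity matrix of size \<open>r l\<close> is zero.\<close>

lemma minimal_resolution_le_projective:
  fixes \<epsilon> :: "'a::comm_ring_1 \<Rightarrow> 'b::comm_ring_1"
  assumes R: "resolution I r (\<lambda>i. carrier_vec (r i)) A"
    and hom: "comm_ring_hom \<epsilon>"
    and min: "\<And>i. map_mat \<epsilon> (A (Suc i)) = 0\<^sub>m (r i) (r (Suc i))"
    and R': "resolution I r' P' A'"
    and proj: "\<And>i. projective_summand (r' i) (P' i)"
    and l: "P' l = {0\<^sub>v (r' l)}"
  shows "r l = 0"
proof -
  have "\<forall>i. \<exists>e. idempotent_mat (r' i) e \<and> P' i = mat_image (r' i) e"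
    using proj unfolding projective_summand_iff by blast
  then obtain e' where e: "\<And>i. idempotent_mat (r' i) (e' i) \<and> P' i = mat_image (r' i) (e' i)"
    unfolding choice_iff by blast
  then have e': "\<And>i. idempotent_mat (r' i) (e' i)" "P' = (\<lambda>i. mat_image (r' i) (e' i))"
    by (blast, intro ext) (use e in blast)
  have ec': "e' i \<in> carrier_mat (r' i) (r' i)" for i using e'(1) by (simp add: idempotent_mat_def)
  have R1: "resolution I r (\<lambda>i. mat_image (r i) (1\<^sub>m (r i))) A"
    using R by (simp only: mat_image_one)
  note R2 = R'[unfolded e'(2)]
  note A0 = resolutionD(2)[OF R] and A'0 = resolutionD(2)[OF R']
  note AS = resolutionD(3)[OF R] and A'S = resolutionD(3)[OF R']
  obtain f where f: "\<And>i. f i \<in> carrier_mat (r' i) (r i)" "\<And>i. e' i * f i = f i"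
    "A' 0 * f 0 = A 0 * 1\<^sub>m (r 0)" "\<And>i. A' (Suc i) * f (Suc i) = f i * A (Suc i) * 1\<^sub>m (r (Suc i))"
    by (rule comparison_map[OF R1 idempotent_one_mat R2 e'(1)]) (rule that)
  obtain g where g: "\<And>i. g i \<in> carrier_mat (r i) (r' i)" "\<And>i. 1\<^sub>m (r i) * g i = g i"
    "A 0 * g 0 = A' 0 * e' 0" "\<And>i. A (Suc i) * g (Suc i) = g i * A' (Suc i) * e' (Suc i)"
    by (rule comparison_map[OF R2 e'(1) R1 idempotent_one_mat]) (rule that)
  have fA: "f i * A (Suc i) \<in> carrier_mat (r' i) (r (Suc i))" for i by (rule mult_carrier_mat[OF f(1) AS])
  have gA: "g i * A' (Suc i) \<in> carrier_mat (r i) (r' (Suc i))" for i by (rule mult_carrier_mat[OF g(1) A'S])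
  have "map_mat \<epsilon> (g l * f l) = 1\<^sub>m (r l)"
  proof (rule minimal_endomorphism[OF R hom min])
    show "g i * f i \<in> carrier_mat (r i) (r i)" for i by (rule mult_carrier_mat[OF g(1) f(1)])
    have "A 0 * (g 0 * f 0) = A' 0 * (e' 0 * f 0)"
      using assoc_mult_mat[OF A0 g(1) f(1)] assoc_mult_mat[OF A'0 ec' f(1)] g(3) by simp
    then show "A 0 * (g 0 * f 0) = A 0" using f(2,3) A0 by simp
    fix i
    have "A (Suc i) * (g (Suc i) * f (Suc i)) = g i * A' (Suc i) * (e' (Suc i) * f (Suc i))"
      using assoc_mult_mat[OF AS g(1) f(1)] assoc_mult_mat[OF gA ec' f(1)] g(4) by simp
    also have "\<dots> = g i * (f i * A (Suc i))"
      using assoc_mult_mat[OF g(1) A'S f(1)] f(2,4) right_mult_one_mat[OF fA] by simp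
    finally show "A (Suc i) * (g (Suc i) * f (Suc i)) = g i * f i * A (Suc i)"
      using assoc_mult_mat[OF g(1) f(1) AS] by simp
  qed
  \<comment> \<open>\<open>e' l * f l = f l\<close> puts every column of \<open>f l\<close> into
    \<open>P' l\<close>, which contains only zero.\<close>
  moreover have "f l = 0\<^sub>m (r' l) (r l)"
  proof (rule mat_col_eqI)
    fix q assume "q < dim_col (0\<^sub>m (r' l) (r l) :: 'a mat)"
    then have q: "q < r l" by simp
    have "col (f l) q = e' l *\<^sub>v col (f l) q" using col_mult2[OF ec' f(1) q] f(2)[of l] by metis
    moreover have "col (f l) q \<in> carrier_vec (r' l)" using f(1)[of l] by (intro carrier_vecI) simp
    ultimately have "col (f l) q \<in> P' l" unfolding e'(2) by (metis imageI)
    then show "col (f l) q = col (0\<^sub>m (r' l) (r l)) q" using l q by (auto intro!: eq_vecI)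
  qed (use f(1)[of l] in auto)
  moreover have "map_mat \<epsilon> (g l * 0\<^sub>m (r' l) (r l)) = 0\<^sub>m (r l) (r l)"
  proof -
    interpret comm_ring_hom \<epsilon> by fact
    show ?thesis using g(1)[of l] by auto
  qed
  ultimately have "1\<^sub>m (r l) = (0\<^sub>m (r l) (r l) :: 'b mat)" by simp
  then have "(1\<^sub>m (r l) :: 'b mat) $$ (0, 0) = 0\<^sub>m (r l) (r l) $$ (0, 0)" by simp
  then show ?thesis by (cases "r l = 0") auto
qed

text \<open>If \<open>m < n\<close>, both matrices can be padded by zeros to size \<open>n\<close>
  without changing the product. A one-sided inverse of a square matrix is two-sided, but row
  \<open>m\<close> of the padded \<open>A\<close> is zero.\<close>

lemma mat_left_inverse_dim_le:
  fixes A B :: "'a::field mat"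
  assumes A: "A \<in> carrier_mat m n" and B: "B \<in> carrier_mat n m" and BA: "B * A = 1\<^sub>m n"
  shows "n \<le> m"
proof (rule ccontr)
  assume "\<not> n \<le> m"
  then have mn: "m < n" by simp
  define A' where "A' = mat n n (\<lambda>(i, j). if i < m then A $$ (i, j) else 0)"
  define B' where "B' = mat n n (\<lambda>(i, j). if j < m then B $$ (i, j) else 0)"
  have A': "A' \<in> carrier_mat n n" and B': "B' \<in> carrier_mat n n" by (auto simp: A'_def B'_def)
  have "B' * A' = 1\<^sub>m n"
  proof (rule eq_matI)
    fix i j assume ij: "i < dim_row (1\<^sub>m n :: 'a mat)" "j < dim_col (1\<^sub>m n :: 'a mat)"
    have "(B' * A') $$ (i, j) = (\<Sum>k<n. B' $$ (i, k) * A' $$ (k, j))"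
      using ij A' B' by (simp add: scalar_prod_def lessThan_atLeast0)
    also have "\<dots> = (\<Sum>k<m. B $$ (i, k) * A $$ (k, j))"
      using ij mn by (intro sum.mono_neutral_cong_right) (auto simp: A'_def B'_def)
    also have "\<dots> = (B * A) $$ (i, j)"
      using ij A B by (simp add: scalar_prod_def lessThan_atLeast0)
    finally show "(B' * A') $$ (i, j) = 1\<^sub>m n $$ (i, j)" using BA by simp
  qed (use A' B' in auto)
  then have "A' * B' = 1\<^sub>m n" by (rule mat_mult_left_right_inverse[OF B' A'])
  then have "(A' * B') $$ (m, m) = 1" using mn by simp
  moreover have "(A' * B') $$ (m, m) = 0"
    using mn A' B' by (simp add: scalar_prod_def A'_def)
  ultimately show False by simp
qed

lemma free_comparison_map:
  assumes R: "resolution I r (\<lambda>i. carrier_vec (r i)) A"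
    and R': "resolution I r' (\<lambda>i. carrier_vec (r' i)) A'"
  obtains f where "\<And>i. f i \<in> carrier_mat (r' i) (r i)" "A' 0 * f 0 = A 0"
    "\<And>i. A' (Suc i) * f (Suc i) = f i * A (Suc i)"
proof -
  note A0 = resolutionD(2)[OF R] and AS = resolutionD(3)[OF R]
  have R1: "resolution I r (\<lambda>i. mat_image (r i) (1\<^sub>m (r i))) A"
    "resolution I r' (\<lambda>i. mat_image (r' i) (1\<^sub>m (r' i))) A'"
    using R R' by (simp_all only: mat_image_one)
  obtain f where f: "\<And>i. f i \<in> carrier_mat (r' i) (r i)" "\<And>i. 1\<^sub>m (r' i) * f i = f i"
    "A' 0 * f 0 = A 0 * 1\<^sub>m (r 0)" "\<And>i. A' (Suc i) * f (Suc i) = f i * A (Suc i) * 1\<^sub>m (r (Suc i))"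
    by (rule comparison_map[OF R1(1) idempotent_one_mat R1(2) idempotent_one_mat]) (rule that)
  have "f i * A (Suc i) \<in> carrier_mat (r' i) (r (Suc i))" for i by (rule mult_carrier_mat[OF f(1) AS])
  then have "f i * A (Suc i) * 1\<^sub>m (r (Suc i)) = f i * A (Suc i)" for i
    by (rule right_mult_one_mat)
  moreover have "A 0 * 1\<^sub>m (r 0) = A 0" by (rule right_mult_one_mat[OF A0])
  ultimately show thesis using f(3,4) by (intro that[OF f(1)]) auto
qed

text \<open>Stated for given \<open>f\<close> and \<open>g\<close>, because one of them will be
  replaced by its degree 0 component. Only one resolution has to be minimal; for two minimal ones,
  swapping the roles gives a two-sided inverse.\<close>

lemma minimal_comparison_inverse:
  assumes R: "resolution I r (\<lambda>i. carrier_vec (r i)) A"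
    and hom: "comm_ring_hom \<epsilon>"
    and min: "\<And>i. map_mat \<epsilon> (A (Suc i)) = 0\<^sub>m (r i) (r (Suc i))"
    and R': "resolution I r' (\<lambda>i. carrier_vec (r' i)) A'"
    and f: "\<And>i. f i \<in> carrier_mat (r' i) (r i)" "A' 0 * f 0 = A 0"
      "\<And>i. A' (Suc i) * f (Suc i) = f i * A (Suc i)"
    and g: "\<And>i. g i \<in> carrier_mat (r i) (r' i)" "A 0 * g 0 = A' 0"
      "\<And>i. A (Suc i) * g (Suc i) = g i * A' (Suc i)"
  shows "map_mat \<epsilon> (g i) * map_mat \<epsilon> (f i) = 1\<^sub>m (r i)"
proof -
  interpret comm_ring_hom \<epsilon> by fact
  note A0 = resolutionD(2)[OF R] and A'0 = resolutionD(2)[OF R']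
  note AS = resolutionD(3)[OF R] and A'S = resolutionD(3)[OF R']
  have "map_mat \<epsilon> (g i * f i) = 1\<^sub>m (r i)"
  proof (rule minimal_endomorphism[OF R hom min])
    show "g i * f i \<in> carrier_mat (r i) (r i)" for i by (rule mult_carrier_mat[OF g(1) f(1)])
    show "A 0 * (g 0 * f 0) = A 0" using assoc_mult_mat[OF A0 g(1) f(1)] f(2) g(2) by metis
    fix i
    have "A (Suc i) * (g (Suc i) * f (Suc i)) = g i * (f i * A (Suc i))"
      using assoc_mult_mat[OF AS g(1) f(1)] assoc_mult_mat[OF g(1) A'S f(1)] f(3) g(3) by simp
    then show "A (Suc i) * (g (Suc i) * f (Suc i)) = g i * f i * A (Suc i)"
      using assoc_mult_mat[OF g(1) f(1) AS] by simp
  qed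
  then show ?thesis using mat_hom_mult[OF g(1) f(1)] by simp
qed

section \<open>The matrices of the cubical complex\<close>

context regular_cubical_family
begin

definition basis :: "nat \<Rightarrow> (nat set \<times> nat set) set" where
  "basis i = {(C, T). C \<in> F \<and> T \<subseteq> exchange_set F C \<and> card T = i}"

definition rank :: "nat \<Rightarrow> nat" where
  "rank i = card (basis i)"

text \<open>Matrices need a numbered basis. Any numbering will do, since all basis elements of one
  homological degree get the same shift.\<close>

definition enum :: "nat \<Rightarrow> nat \<Rightarrow> nat set \<times> nat set" where
  "enum i = (SOME h. bij_betw h {..<rank i} (basis i))"

definition unit_chain :: "nat set \<times> nat set \<Rightarrow> nat set \<Rightarrow> nat set \<Rightarrow> 'a" where
  "unit_chain b C T = (if (C, T) = b then 1 else 0)"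

definition diff_mat :: "nat \<Rightarrow> 'a mat" where
  "diff_mat i = (case i of
     0 \<Rightarrow> mat 1 (rank 0) (\<lambda>(p, q). gen (fst (enum 0 q)))
   | Suc j \<Rightarrow> mat (rank j) (rank i)
       (\<lambda>(p, q). bdry (unit_chain (enum i q)) (fst (enum j p)) (snd (enum j p))))"

definition vec_of_chain :: "nat \<Rightarrow> (nat set \<Rightarrow> nat set \<Rightarrow> 'a) \<Rightarrow> 'a vec" where
  "vec_of_chain i v = vec (rank i) (\<lambda>p. v (fst (enum i p)) (snd (enum i p)))"

lemma finite_F: "finite F"
  using finite_subset[of F "Pow N"] finite_N F_subset by auto

lemma basis_finite: "finite (basis i)"
proof (rule finite_subset)
  show "basis i \<subseteq> F \<times> Pow N" using exchange_set_subset by (auto simp: basis_def)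
qed (use finite_F finite_N in simp)

lemma basis_finite_snd: "b \<in> basis i \<Longrightarrow> finite (snd b)"
  using finite_subset[OF subset_trans[OF _ exchange_set_subset] finite_N]
  by (cases b) (auto simp: basis_def)

lemma bij_enum: "bij_betw (enum i) {..<rank i} (basis i)"
proof -
  have "\<exists>h. bij_betw h {..<rank i} (basis i)"
    using ex_bij_betw_nat_finite[OF basis_finite] by (simp add: rank_def lessThan_atLeast0)
  then show ?thesis unfolding enum_def by (rule someI_ex)
qed

lemma enum_in_basis: "p < rank i \<Longrightarrow> enum i p \<in> basis i"
  using bij_betwE[OF bij_enum] by simp

lemma vec_of_chain_carrier [simp]: "vec_of_chain i v \<in> carrier_vec (rank i)"
  by (simp add: vec_of_chain_def)

lemma chains_eq_0:
  assumes "v \<in> chains F i" "vec_of_chain i v = 0\<^sub>v (rank i)"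
  shows "v = (\<lambda>C T. 0)"
proof (intro ext, rule ccontr)
  fix C T assume nz: "v C T \<noteq> 0"
  then have "(C, T) \<in> basis i" using chainsD[OF assms(1)] by (auto simp: basis_def)
  then obtain p where p: "p < rank i" "enum i p = (C, T)"
    using bij_enum[of i] unfolding bij_betw_def by (metis imageE lessThan_iff)
  have "vec_of_chain i v $ p = 0" using assms(2) p(1) by simp
  then show False using nz p by (simp add: vec_of_chain_def)
qed

lemma sum_enum: "(\<Sum>q<rank i. f (enum i q)) = (\<Sum>b\<in>basis i. f b)"
  by (rule sum.reindex_bij_betw[OF bij_enum])

lemma vec_of_chain_surj:
  assumes "w \<in> carrier_vec (rank i)"
  obtains v where "v \<in> chains F i" "vec_of_chain i v = w"
proof
  define g where "g = inv_into {..<rank i} (enum i)"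
  define v where "v C T = (if (C, T) \<in> basis i then w $ g (C, T) else 0)" for C T
  show "v \<in> chains F i" by (auto simp: v_def chains_def basis_def)
  have "g (enum i p) = p" if "p < rank i" for p
    unfolding g_def using that bij_enum[of i] by (intro inv_into_f_f) (auto simp: bij_betw_def)
  then show "vec_of_chain i v = w"
    using assms enum_in_basis by (intro eq_vecI) (auto simp: vec_of_chain_def v_def)
qed

lemma diff_mat_carrier:
  "diff_mat 0 \<in> carrier_mat 1 (rank 0)" "diff_mat (Suc i) \<in> carrier_mat (rank i) (rank (Suc i))"
  by (simp_all add: diff_mat_def)

lemma diff_eq_sum:
  assumes "v \<in> chains F i"
  shows "bdry v C T = (\<Sum>b\<in>basis i. bdry (unit_chain b) C T * v (fst b) (snd b))"
proof -
  have v: "v D U = (\<Sum>b\<in>basis i. unit_chain b D U * v (fst b) (snd b))" for D U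
  proof -
    have "(\<Sum>b\<in>basis i. unit_chain b D U * v (fst b) (snd b)) =
      (\<Sum>b\<in>basis i. if b = (D, U) then v D U else 0)"
      by (intro sum.cong) (auto simp: unit_chain_def)
    also have "\<dots> = (if (D, U) \<in> basis i then v D U else 0)" by (simp add: basis_finite)
    also have "\<dots> = v D U" using chainsD[OF assms, of D U] by (auto simp: basis_def)
    finally show ?thesis by simp
  qed
  have "bdry v C T = (\<Sum>s\<in>N - T. \<Sum>b\<in>basis i. koszul_sign s T * (if s \<in> C then x s else - y s) *
      unit_chain b (insert s C) (insert s T) * v (fst b) (snd b))"
    unfolding cube_diff_def by (subst v) (simp add: sum_distrib_left mult.assoc)
  also have "\<dots> = (\<Sum>b\<in>basis i. bdry (unit_chain b) C T * v (fst b) (snd b))"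
    unfolding cube_diff_def sum_distrib_right by (rule sum.swap)
  finally show ?thesis .
qed

lemma diff_mat_Suc_mult:
  assumes "v \<in> chains F (Suc i)"
  shows "diff_mat (Suc i) *\<^sub>v vec_of_chain (Suc i) v = vec_of_chain i (bdry v)"
proof (rule eq_vecI)
  fix p assume "p < dim_vec (vec_of_chain i (bdry v))"
  then have p: "p < rank i" by (simp add: vec_of_chain_def)
  obtain C T where CT: "enum i p = (C, T)" by fastforce
  have "(diff_mat (Suc i) *\<^sub>v vec_of_chain (Suc i) v) $ p = (\<Sum>q<rank (Suc i).
    bdry (unit_chain (enum (Suc i) q)) C T * v (fst (enum (Suc i) q)) (snd (enum (Suc i) q)))"
    using p CT by (simp add: diff_mat_def vec_of_chain_def scalar_prod_def lessThan_atLeast0)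
  also have "\<dots> = bdry v C T"
    unfolding diff_eq_sum[OF assms] by (rule sum_enum)
  finally show "(diff_mat (Suc i) *\<^sub>v vec_of_chain (Suc i) v) $ p = vec_of_chain i (bdry v) $ p"
    using p CT by (simp add: vec_of_chain_def)
qed (simp add: diff_mat_def vec_of_chain_def)

lemma basis_0: "basis 0 = (\<lambda>C. (C, {})) ` F"
proof (intro equalityI subsetI)
  fix b assume b: "b \<in> basis 0"
  then have "snd b = {}" using basis_finite_snd[OF b] by (auto simp: basis_def)
  then show "b \<in> (\<lambda>C. (C, {})) ` F" using b by (cases b) (auto simp: basis_def)
qed (auto simp: basis_def)

lemma aug_eq_sum:
  assumes "v \<in> chains F 0"
  shows "aug v = (\<Sum>C\<in>F. gen C * v C {})"
  unfolding aug_def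
proof (rule sum.mono_neutral_right)
  show "\<forall>C\<in>Pow N - F. gen C * v C {} = 0"
    using chainsD(1)[OF assms] by (metis DiffD2 mult_zero_right)
qed (use finite_N F_subset in auto)

lemma diff_mat_0_mult:
  assumes "v \<in> chains F 0"
  shows "diff_mat 0 *\<^sub>v vec_of_chain 0 v = vec 1 (\<lambda>_. aug v)"
proof (rule eq_vecI)
  fix p assume "p < dim_vec (vec 1 (\<lambda>_. aug v))"
  then have p: "p = 0" by simp
  have "(diff_mat 0 *\<^sub>v vec_of_chain 0 v) $ 0 =
    (\<Sum>q<rank 0. gen (fst (enum 0 q)) * v (fst (enum 0 q)) (snd (enum 0 q)))"
    by (simp add: diff_mat_def vec_of_chain_def scalar_prod_def lessThan_atLeast0)
  also have "\<dots> = (\<Sum>b\<in>basis 0. gen (fst b) * v (fst b) (snd b))" by (rule sum_enum)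
  also have "\<dots> = aug v"
    unfolding basis_0 aug_eq_sum[OF assms] by (subst sum.reindex) (auto simp: inj_on_def)
  finally show "(diff_mat 0 *\<^sub>v vec_of_chain 0 v) $ p = vec 1 (\<lambda>_. aug v) $ p" by (simp add: p)
qed (simp add: diff_mat_def)

lemma diff_mat_kernel:
  assumes v: "v \<in> chains F i"
  shows "diff_mat i *\<^sub>v vec_of_chain i v = 0\<^sub>v (dim_row (diff_mat i)) \<longleftrightarrow>
    (if i = 0 then aug v = 0 else bdry v = (\<lambda>C T. 0))"
proof (cases i)
  case 0
  have "vec 1 (\<lambda>_. aug v) = 0\<^sub>v (dim_row (diff_mat 0)) \<longleftrightarrow> aug v = 0"
    by (auto simp: vec_eq_iff diff_mat_def)
  then show ?thesis using diff_mat_0_mult v by (simp add: 0)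
next
  case (Suc j)
  have "bdry v \<in> chains F j" using diff_in_chains[OF initial_F] v Suc by blast
  moreover have "vec_of_chain j (\<lambda>C T. 0) = 0\<^sub>v (rank j)"
    by (auto simp: vec_of_chain_def)
  ultimately have "vec_of_chain j (bdry v) = 0\<^sub>v (rank j) \<longleftrightarrow> bdry v = (\<lambda>C T. 0)"
    using chains_eq_0 by metis
  then show ?thesis using diff_mat_Suc_mult v Suc diff_mat_carrier(2)[of j] by simp
qed

text \<open>\<open>cube_diff_cube_diff\<close> covers finite \<open>T\<close>; elsewhere the double
  boundary vanishes because its support consists of subsets of \<open>N\<close>.\<close>

lemma diff_diff:
  assumes "v \<in> chains F (Suc (Suc i))"
  shows "bdry (bdry v) = (\<lambda>C T. 0)"
proof (intro ext)
  fix C T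
  have "bdry (bdry v) \<in> chains F i" using assms diff_in_chains[OF initial_F] by blast
  then show "bdry (bdry v) C T = 0"
    using chainsD(1,2)[of "bdry (bdry v)" F i C T] exchange_set_subset finite_N
      cube_diff_cube_diff[OF finite_N] finite_subset by metis
qed

text \<open>Transfers exactness from chains to vectors: \<open>vec_of_chain\<close> identifies
  \<open>chains F i\<close> with the column vectors of length \<open>rank i\<close> and turns
  \<open>bdry\<close> and \<open>aug\<close> into matrix multiplication.\<close>

lemma resolution_diff_mat:
  assumes I: "I = {\<Sum>C\<in>F. gen C * c C | c. True}"
  shows "resolution I rank (\<lambda>i. carrier_vec (rank i)) diff_mat"
  unfolding resolution_def
proof (intro conjI allI diff_mat_carrier)
  have I': "I = aug ` chains F 0"
  proof (intro equalityI subsetI)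
    fix f assume "f \<in> I"
    then obtain c where f: "f = (\<Sum>C\<in>F. gen C * c C)" using I by blast
    define v :: "nat set \<Rightarrow> nat set \<Rightarrow> 'a"
      where "v C T = (if C \<in> F \<and> T = {} then c C else 0)" for C T
    have v: "v \<in> chains F 0" by (auto simp: v_def chains_def)
    have "aug v = f" unfolding f aug_eq_sum[OF v] by (intro sum.cong) (auto simp: v_def)
    then show "f \<in> aug ` chains F 0" using v by blast
  next
    fix f assume "f \<in> aug ` chains F 0"
    then obtain v where "v \<in> chains F 0" "f = aug v" by blast
    then show "f \<in> I"
      unfolding I by (intro CollectI exI[of _ "\<lambda>C. v C {}"]) (simp add: aug_eq_sum)
  qed
  show "(\<lambda>v. diff_mat 0 *\<^sub>v v) ` carrier_vec (rank 0) = {vec 1 (\<lambda>_. f) | f. f \<in> I}"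
  proof (intro equalityI subsetI)
    fix u assume "u \<in> (\<lambda>v. diff_mat 0 *\<^sub>v v) ` carrier_vec (rank 0)"
    then obtain w where w: "w \<in> carrier_vec (rank 0)" "u = diff_mat 0 *\<^sub>v w" by blast
    obtain v where "v \<in> chains F 0" "vec_of_chain 0 v = w" by (rule vec_of_chain_surj[OF w(1)])
    then show "u \<in> {vec 1 (\<lambda>_. f) | f. f \<in> I}" using w(2) diff_mat_0_mult I' by blast
  next
    fix u assume "u \<in> {vec 1 (\<lambda>_. f) | f. f \<in> I}"
    then obtain v where "v \<in> chains F 0" "u = vec 1 (\<lambda>_. aug v)" using I' by blast
    then show "u \<in> (\<lambda>v. diff_mat 0 *\<^sub>v v) ` carrier_vec (rank 0)"
      using diff_mat_0_mult vec_of_chain_carrier by (metis imageI)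
  qed
  show "(\<lambda>v. diff_mat (Suc i) *\<^sub>v v) ` carrier_vec (rank (Suc i)) =
    {v \<in> carrier_vec (rank i). diff_mat i *\<^sub>v v = 0\<^sub>v (dim_row (diff_mat i))}" for i
  proof (intro equalityI subsetI)
    fix u assume "u \<in> (\<lambda>v. diff_mat (Suc i) *\<^sub>v v) ` carrier_vec (rank (Suc i))"
    then obtain w where w: "w \<in> carrier_vec (rank (Suc i))" "u = diff_mat (Suc i) *\<^sub>v w" by blast
    obtain v where v: "v \<in> chains F (Suc i)" "vec_of_chain (Suc i) v = w"
      by (rule vec_of_chain_surj[OF w(1)])
    then have u: "u = vec_of_chain i (bdry v)" using w(2) diff_mat_Suc_mult by blast
    have "bdry v \<in> chains F i" by (rule diff_in_chains[OF initial_F v(1)])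
    moreover have "if i = 0 then aug (bdry v) = 0 else bdry (bdry v) = (\<lambda>C T. 0)"
      using aug_diff diff_diff[of v "i - 1"] v(1) by (cases i) auto
    ultimately show "u \<in> {v \<in> carrier_vec (rank i). diff_mat i *\<^sub>v v = 0\<^sub>v (dim_row (diff_mat i))}"
      using diff_mat_kernel[of "bdry v" i] vec_of_chain_carrier[of i "bdry v"] unfolding u
      by blast
  next
    fix u assume "u \<in> {v \<in> carrier_vec (rank i). diff_mat i *\<^sub>v v = 0\<^sub>v (dim_row (diff_mat i))}"
    then have u: "u \<in> carrier_vec (rank i)" "diff_mat i *\<^sub>v u = 0\<^sub>v (dim_row (diff_mat i))" by auto
    obtain v where v: "v \<in> chains F i" "vec_of_chain i v = u" by (rule vec_of_chain_surj[OF u(1)])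
    then have "if i = 0 then aug v = 0 else bdry v = (\<lambda>C T. 0)" using diff_mat_kernel u(2) by blast
    then obtain w where "w \<in> chains F (Suc i)" "bdry w = v"
      using exact[OF v(1)] by (auto split: if_splits)
    then show "u \<in> (\<lambda>v. diff_mat (Suc i) *\<^sub>v v) ` carrier_vec (rank (Suc i))"
      using diff_mat_Suc_mult v(2) vec_of_chain_carrier by (metis imageI)
  qed
qed auto

lemma rank_eq: "rank i = (\<Sum>C\<in>F. card (exchange_set F C) choose i)"
proof -
  have fin: "finite (exchange_set F C)" if "C \<in> F" for C
    using that exchange_set_subset finite_N finite_subset by blast
  have "basis i = (SIGMA C:F. {T. T \<subseteq> exchange_set F C \<and> card T = i})"
    by (auto simp: basis_def)
  then have "rank i = (\<Sum>C\<in>F. card {T. T \<subseteq> exchange_set F C \<and> card T = i})"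
    unfolding rank_def using finite_F fin by (simp add: card_SigmaI)
  also have "\<dots> = (\<Sum>C\<in>F. card (exchange_set F C) choose i)"
    using fin by (intro sum.cong) (simp_all add: n_subsets)
  finally show ?thesis .
qed

end

section \<open>Polynomials and monomial ideals\<close>

lemma keys_mult_cases:
  assumes "k \<in> Poly_Mapping.keys (f * g)"
  obtains a b where "k = a + b" "a \<in> Poly_Mapping.keys f" "b \<in> Poly_Mapping.keys g"
  using assms keys_mult[of f g] by blast

text \<open>Exponents are natural numbers, so two of them add up to 0 only if both are 0. Hence
  taking the constant term is a ring homomorphism, the reduction modulo the graded maximal ideal
  used as \<open>\<epsilon>\<close>.\<close>

lemma lookup_mult_0:
  fixes f g :: "('v \<Rightarrow>\<^sub>0 nat) \<Rightarrow>\<^sub>0 'k::comm_ring_1"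
  shows "Poly_Mapping.lookup (f * g) 0 = Poly_Mapping.lookup f 0 * Poly_Mapping.lookup g 0"
proof -
  have add_eq_0: "a = 0 \<and> b = 0" if "a + b = 0" for a b :: "'v \<Rightarrow>\<^sub>0 nat"
    using that by (simp add: poly_mapping_eq_iff fun_eq_iff lookup_add)
  have vanish: "Poly_Mapping.lookup (p * q) 0 = 0"
    if "0 \<notin> Poly_Mapping.keys p \<or> 0 \<notin> Poly_Mapping.keys q"
    for p q :: "('v \<Rightarrow>\<^sub>0 nat) \<Rightarrow>\<^sub>0 'k"
  proof (rule ccontr)
    assume "Poly_Mapping.lookup (p * q) 0 \<noteq> 0"
    then have "0 \<in> Poly_Mapping.keys (p * q)" by (simp add: in_keys_iff)
    then show False using that add_eq_0 by (metis keys_mult_cases)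
  qed
  have split: "\<exists>h. p = Poly_Mapping.single 0 (Poly_Mapping.lookup p 0) + h \<and> 0 \<notin> Poly_Mapping.keys h"
    for p :: "('v \<Rightarrow>\<^sub>0 nat) \<Rightarrow>\<^sub>0 'k"
    by (intro exI[of _ "p - Poly_Mapping.single 0 (Poly_Mapping.lookup p 0)"])
      (simp add: in_keys_iff lookup_minus)
  define a b where "a = Poly_Mapping.lookup f 0" and "b = Poly_Mapping.lookup g 0"
  obtain f' where f': "f = Poly_Mapping.single 0 a + f'" "0 \<notin> Poly_Mapping.keys f'"
    using split unfolding a_def by blast
  obtain g' where g': "g = Poly_Mapping.single 0 b + g'" "0 \<notin> Poly_Mapping.keys g'"
    using split unfolding b_def by blast
  have "f * g = Poly_Mapping.single 0 a * (Poly_Mapping.single 0 b + g') + f' * g"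
    using f'(1) g'(1) by (metis distrib_right)
  then have "f * g = Poly_Mapping.single 0 (a * b) + Poly_Mapping.single 0 a * g' + f' * g"
    by (simp add: distrib_left mult_single)
  then show ?thesis
    using vanish f'(2) g'(2) by (simp add: lookup_add flip: a_def b_def)
qed

lemma comm_ring_hom_lookup_0:
  "comm_ring_hom (\<lambda>f :: ('v \<Rightarrow>\<^sub>0 nat) \<Rightarrow>\<^sub>0 'k::comm_ring_1. Poly_Mapping.lookup f 0)"
  by unfold_locales (simp_all add: lookup_add lookup_mult_0)

section \<open>Homogeneous components of polynomials\<close>

definition homogeneous :: "int \<Rightarrow> ('v::finite, 'k::field) mpoly \<Rightarrow> bool" where
  "homogeneous k f \<longleftrightarrow> (\<forall>m\<in>Poly_Mapping.keys f. int (mon_degree m) = k)"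

definition degree_part :: "int \<Rightarrow> ('v::finite, 'k::field) mpoly \<Rightarrow> ('v, 'k) mpoly" where
  "degree_part k f = Poly_Mapping.mapp (\<lambda>m c. if int (mon_degree m) = k then c else 0) f"

lemma lookup_degree_part:
  "Poly_Mapping.lookup (degree_part k f) m =
    (if int (mon_degree m) = k then Poly_Mapping.lookup f m else 0)"
  by (auto simp: degree_part_def lookup_mapp when_def in_keys_iff)

lemma degree_part_add: "degree_part k (f + g) = degree_part k f + degree_part k g"
  by (rule poly_mapping_eqI) (simp add: lookup_degree_part lookup_add)

lemma degree_part_sum: "degree_part k (\<Sum>i\<in>S. f i) = (\<Sum>i\<in>S. degree_part k (f i))"
  by (rule poly_mapping_eqI) (simp add: lookup_degree_part lookup_sum)

lemma homogeneous_degree_part: "homogeneous k (degree_part k f)"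
  by (auto simp: homogeneous_def in_keys_iff lookup_degree_part split: if_splits)

lemma degree_part_homogeneous:
  assumes "homogeneous j f"
  shows "degree_part k f = (if j = k then f else 0)"
  using assms
  by (intro poly_mapping_eqI) (auto simp: lookup_degree_part homogeneous_def in_keys_iff)

lemma mon_degree_add: "mon_degree (a + b) = mon_degree a + mon_degree b"
  by (simp add: mon_degree_def lookup_add sum.distrib)

lemma homogeneous_mult:
  assumes "homogeneous i f" "homogeneous j g"
  shows "homogeneous (i + j) (f * g)"
  using assms unfolding homogeneous_def
  by (metis keys_mult_cases mon_degree_add of_nat_add)

lemma homogeneous_degree_eq_0:
  assumes "homogeneous k f" "Poly_Mapping.lookup f 0 \<noteq> 0"
  shows "k = 0"
proof -
  have "0 \<in> Poly_Mapping.keys f" using assms(2) by (simp add: in_keys_iff)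
  then have "int (mon_degree (0 :: 'a \<Rightarrow>\<^sub>0 nat)) = k" using assms(1) by (simp only: homogeneous_def)
  then show ?thesis by (simp add: mon_degree_def)
qed

lemma degree_part_mult_left:
  assumes "homogeneous j a"
  shows "degree_part k (a * f) = a * degree_part (k - j) f"
proof -
  define h where "h = f - degree_part (k - j) f"
  have f: "f = degree_part (k - j) f + h" by (simp add: h_def)
  have h: "int (mon_degree m) \<noteq> k - j" if "m \<in> Poly_Mapping.keys h" for m
    using that by (auto simp: h_def in_keys_iff lookup_minus lookup_degree_part)
  have "degree_part k (a * h) = 0"
  proof (rule poly_mapping_eqI)
    fix m
    have "int (mon_degree m) \<noteq> k" if m: "m \<in> Poly_Mapping.keys (a * h)"
    proof -
      obtain p q where pq: "m = p + q" "p \<in> Poly_Mapping.keys a" "q \<in> Poly_Mapping.keys h"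
        using m by (rule keys_mult_cases)
      then show ?thesis using assms h[OF pq(3)] by (auto simp: homogeneous_def mon_degree_add)
    qed
    then show "Poly_Mapping.lookup (degree_part k (a * h)) m = Poly_Mapping.lookup 0 m"
      by (auto simp: lookup_degree_part in_keys_iff)
  qed
  moreover have "degree_part k (a * degree_part (k - j) f) = a * degree_part (k - j) f"
    using degree_part_homogeneous[OF homogeneous_mult[OF assms homogeneous_degree_part], of k "k - j" f]
    by simp
  ultimately show ?thesis by (subst f) (simp add: distrib_left degree_part_add)
qed

lemma degree_part_mult_right:
  "homogeneous j a \<Longrightarrow> degree_part k (f * a) = degree_part (k - j) f * a"
  using degree_part_mult_left[of j a k f] by (simp add: mult.commute)

section \<open>Monomials and monomial ideals\<close>

definition squarefree_exp :: "'v set \<Rightarrow> 'v \<Rightarrow>\<^sub>0 nat" where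
  "squarefree_exp A = (\<Sum>v\<in>A. Poly_Mapping.single v 1)"

lemma lookup_squarefree_exp:
  "finite A \<Longrightarrow> Poly_Mapping.lookup (squarefree_exp A) v = (if v \<in> A then 1 else 0)"
  by (simp add: squarefree_exp_def lookup_sum lookup_single when_def)

lemma prod_var: "(\<Prod>v\<in>A. var v) = Poly_Mapping.single (squarefree_exp (A :: 'v::finite set)) (1 :: 'k::field)"
  unfolding squarefree_exp_def using finite[of A]
  by induction (simp_all add: var_def mult_single)

lemma mon_degree_squarefree_exp: "mon_degree (squarefree_exp A) = card A"
  unfolding mon_degree_def by (simp add: lookup_squarefree_exp flip: sum.inter_restrict)

lemma lookup_monom_mult:
  fixes f :: "('v \<Rightarrow>\<^sub>0 nat) \<Rightarrow>\<^sub>0 'k::comm_ring_1"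
  shows "Poly_Mapping.lookup (Poly_Mapping.single m 1 * f) (m + k) = Poly_Mapping.lookup f k"
proof -
  define h where "h = f - Poly_Mapping.single k (Poly_Mapping.lookup f k)"
  have "m + k \<notin> Poly_Mapping.keys (Poly_Mapping.single m 1 * h)"
  proof
    assume "m + k \<in> Poly_Mapping.keys (Poly_Mapping.single m 1 * h)"
    then obtain a b where "m + k = a + b" "a \<in> Poly_Mapping.keys (Poly_Mapping.single m (1::'k))"
      "b \<in> Poly_Mapping.keys h" by (rule keys_mult_cases)
    then show False by (auto simp: h_def in_keys_iff lookup_minus split: if_splits)
  qed
  then have "Poly_Mapping.lookup (Poly_Mapping.single m 1 * h) (m + k) = 0" by (simp add: in_keys_iff)
  moreover have "Poly_Mapping.single m 1 * f = Poly_Mapping.single (m + k) (Poly_Mapping.lookup f k) +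
    Poly_Mapping.single m 1 * h"
    by (simp add: h_def right_diff_distrib mult_single)
  ultimately show ?thesis by (simp add: lookup_add)
qed

text \<open>Multiplication by a monomial shifts exponents without cancellation, so each monomial of
  \<open>a\<close> reappears on the left as \<open>m + k\<close> and must be divisible by one of the
  monomials on the right. Colon ideals by monomials can thus be tested monomial by monomial.\<close>

lemma monomial_quotient_keys:
  fixes a :: "('v::finite, 'k::field) mpoly"
  assumes "Poly_Mapping.single m 1 * a = (\<Sum>D\<in>G. Poly_Mapping.single (e D) 1 * c D)"
    and "k \<in> Poly_Mapping.keys a"
  obtains D where "D \<in> G" "\<And>v. Poly_Mapping.lookup (e D) v \<le> Poly_Mapping.lookup m v + Poly_Mapping.lookup k v"
proof -
  have "m + k \<in> Poly_Mapping.keys (Poly_Mapping.single m 1 * a)"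
    using assms(2) by (simp add: in_keys_iff lookup_monom_mult)
  then obtain D where D: "D \<in> G" "m + k \<in> Poly_Mapping.keys (Poly_Mapping.single (e D) 1 * c D)"
    unfolding assms(1) using keys_sum by fastforce
  then obtain b where "m + k = e D + b" by (auto elim!: keys_mult_cases split: if_splits)
  then have "Poly_Mapping.lookup (e D) v \<le> Poly_Mapping.lookup m v + Poly_Mapping.lookup k v" for v
    by (metis le_add1 lookup_add)
  then show thesis using that D(1) by blast
qed

text \<open>Each monomial of \<open>a\<close> is assigned one of the variables dividing it;
  \<open>b s\<close> collects the quotients of the monomials assigned to \<open>s\<close>.\<close>

lemma in_variable_ideal:
  fixes a :: "('v::finite, 'k::field) mpoly"
  assumes "finite V" "\<And>k. k \<in> Poly_Mapping.keys a \<Longrightarrow> \<exists>t\<in>V. Poly_Mapping.lookup k (x t) > 0"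
  shows "\<exists>b. a = (\<Sum>t\<in>V. var (x t) * b t)"
proof -
  obtain t where t: "\<And>k. k \<in> Poly_Mapping.keys a \<Longrightarrow> t k \<in> V \<and> Poly_Mapping.lookup k (x (t k)) > 0"
    using assms(2) by metis
  define b where "b s = (\<Sum>k\<in>{k\<in>Poly_Mapping.keys a. t k = s}.
    Poly_Mapping.single (k - Poly_Mapping.single (x s) 1) (Poly_Mapping.lookup a k))" for s
  have mon: "var (x s) * Poly_Mapping.single (k - Poly_Mapping.single (x s) 1) (Poly_Mapping.lookup a k) =
    Poly_Mapping.single k (Poly_Mapping.lookup a k)"
    if "k \<in> Poly_Mapping.keys a" "t k = s" for k s
  proof -
    have "Poly_Mapping.single (x s) 1 + (k - Poly_Mapping.single (x s) 1) = k"
      using t[OF that(1)] that(2)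
      by (intro poly_mapping_eqI) (auto simp: lookup_add lookup_minus lookup_single when_def)
    then show ?thesis by (simp add: var_def mult_single)
  qed
  have "a = (\<Sum>k\<in>Poly_Mapping.keys a. Poly_Mapping.single k (Poly_Mapping.lookup a k))"
    by (rule poly_mapping_eqI) (auto simp: lookup_sum lookup_single when_def in_keys_iff)
  also have "\<dots> = (\<Sum>s\<in>V. \<Sum>k\<in>{k\<in>Poly_Mapping.keys a. t k = s}.
    Poly_Mapping.single k (Poly_Mapping.lookup a k))"
    using assms(1) t by (intro sum.group[symmetric]) auto
  also have "\<dots> = (\<Sum>s\<in>V. var (x s) * b s)"
    unfolding b_def sum_distrib_left using mon by (intro sum.cong) auto
  finally show ?thesis by blast
qed

text \<open>Turns the abstract generated ideal into explicit sums, the form in which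
  \<open>resolution_diff_mat\<close> expects \<open>I\<close>.\<close>

lemma ideal_generated_by_image:
  fixes h :: "'i \<Rightarrow> ('v::finite, 'k::field) mpoly"
  assumes "finite G"
  shows "Idl\<^bsub>poly_ring\<^esub> (h ` G) = {\<Sum>i\<in>G. h i * c i | c. True}" (is "_ = ?J")
proof -
  let ?R = "poly_ring :: ('v, 'k) mpoly ring"
  interpret cring ?R by (rule cring_from_type_algebra)
  have R: "carrier ?R = UNIV" "monoid.mult ?R = (\<lambda>a b. a * b)" "add ?R = (\<lambda>a b. a + b)" "\<zero>\<^bsub>?R\<^esub> = 0"
    by (simp_all add: ring_of_type_algebra_def)
  have inv: "\<ominus>\<^bsub>?R\<^esub> a = - a" for a
    using R by (intro minus_equality) auto
  have JI: "a \<in> ?J" if "a = (\<Sum>i\<in>G. h i * c i)" for a c using that by blast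
  have J: "ideal ?J ?R"
  proof (rule idealI[OF ring_axioms])
    show "subgroup ?J (add_monoid ?R)"
    proof (rule add.subgroupI)
      show "?J \<noteq> {}" using JI by blast
      show "\<ominus>\<^bsub>?R\<^esub> a \<in> ?J" if a: "a \<in> ?J" for a
      proof -
        obtain c where "a = (\<Sum>i\<in>G. h i * c i)" using a by blast
        then have "- a = (\<Sum>i\<in>G. h i * - c i)" by (simp add: sum_negf)
        then show ?thesis unfolding inv by (rule JI)
      qed
      show "a \<oplus>\<^bsub>?R\<^esub> b \<in> ?J" if ab: "a \<in> ?J" "b \<in> ?J" for a b
      proof -
        obtain c d where "a = (\<Sum>i\<in>G. h i * c i)" "b = (\<Sum>i\<in>G. h i * d i)" using ab by blast
        then have "a + b = (\<Sum>i\<in>G. h i * (c i + d i))" by (simp add: distrib_left sum.distrib)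
        then show ?thesis unfolding R by (rule JI)
      qed
    qed (simp add: R)
    have *: "a * b \<in> ?J" "b * a \<in> ?J" if a: "a \<in> ?J" for a b
    proof -
      obtain c where "a = (\<Sum>i\<in>G. h i * c i)" using a by blast
      then have "a * b = (\<Sum>i\<in>G. h i * (c i * b))" by (simp add: sum_distrib_right mult.assoc)
      then show "a * b \<in> ?J" by (rule JI)
      then show "b * a \<in> ?J" by (simp only: mult.commute)
    qed
    show "b \<otimes>\<^bsub>?R\<^esub> a \<in> ?J" "a \<otimes>\<^bsub>?R\<^esub> b \<in> ?J" if "a \<in> ?J" "b \<in> carrier ?R" for a b
      unfolding R by (rule *[OF that(1)])+
  qed
  show ?thesis
  proof (intro equalityI)
    show "Idl\<^bsub>?R\<^esub> (h ` G) \<subseteq> ?J"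
    proof (rule genideal_minimal[OF J])
      show "h ` G \<subseteq> ?J"
      proof
        fix a assume "a \<in> h ` G"
        then obtain i where i: "i \<in> G" "a = h i" by blast
        have "(\<Sum>j\<in>G. h j * (if j = i then 1 else 0)) = (\<Sum>j\<in>G. if j = i then h j else 0)"
          by (intro sum.cong) auto
        then have "a = (\<Sum>j\<in>G. h j * (if j = i then 1 else 0))" using assms i by simp
        then show "a \<in> ?J" by (rule JI)
      qed
    qed
    show "?J \<subseteq> Idl\<^bsub>?R\<^esub> (h ` G)"
    proof
      fix a assume "a \<in> ?J"
      then obtain c where a: "a = (\<Sum>i\<in>G. h i * c i)" by blast
      interpret I: ideal "Idl\<^bsub>?R\<^esub> (h ` G)" ?R by (rule genideal_ideal) (simp add: R)
      have gen: "h i * c i \<in> Idl\<^bsub>?R\<^esub> (h ` G)" if "i \<in> G" for i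
        using I.I_r_closed[of "h i" "c i"] genideal_self[of "h ` G"] that by (auto simp: R)
      have "(\<Sum>i\<in>S. h i * c i) \<in> Idl\<^bsub>?R\<^esub> (h ` G)" if "S \<subseteq> G" for S
        using finite_subset[OF that assms] that
      proof (induction S)
        case empty
        then show ?case using I.zero_closed by (simp add: R)
      next
        case (insert i S)
        then show ?case using I.a_closed[OF gen[of i]] by (simp add: R)
      qed
      then show "a \<in> Idl\<^bsub>?R\<^esub> (h ` G)" unfolding a by blast
    qed
  qed
qed

section \<open>Minimal vertex covers\<close>

locale unmixed_labelled_graph =
  fixes E :: "'v::finite set set" and n :: nat and x y :: "nat \<Rightarrow> 'v"
  assumes simple: "simple_graph E" and unmixed: "unmixed E"
    and labelling: "standard_labelling E n x y"
begin

definition cover_of :: "nat set \<Rightarrow> 'v set" where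
  "cover_of C = y ` C \<union> x ` ({1..n} - C)"

definition cover_family :: "nat set set" where
  "cover_family = {C. C \<subseteq> {1..n} \<and> vertex_cover E (cover_of C)}"

lemma labelling_conditions:
  "inj_on x {1..n}" "inj_on y {1..n}" "x ` {1..n} \<inter> y ` {1..n} = {}"
  "x ` {1..n} \<union> y ` {1..n} = UNIV" "x ` {1..n} \<in> min_vertex_covers E"
  "max_independent_set E (y ` {1..n})" "\<forall>i\<in>{1..n}. {x i, y i} \<in> E"
  "\<forall>i\<in>{1..n}. \<forall>j\<in>{1..n}. {x i, y j} \<in> E \<longrightarrow> i \<le> j"
  using labelling unfolding standard_labelling_def by - (elim conjE, assumption)+

lemmas inj_x = labelling_conditions(1) and inj_y = labelling_conditions(2)
  and vertices = labelling_conditions(4) and x_min_cover = labelling_conditions(5)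
  and matching = bspec[OF labelling_conditions(7)]
  and edge_le = mp[OF bspec[OF bspec[OF labelling_conditions(8)]]]

lemma x_neq_y: "i \<in> {1..n} \<Longrightarrow> j \<in> {1..n} \<Longrightarrow> x i \<noteq> y j"
  using labelling_conditions(3) by (metis disjoint_iff imageI)

lemma y_independent: "independent_set E (y ` {1..n})"
  using labelling_conditions(6) by (simp add: max_independent_set_def)

lemma x_in_cover_of:
  assumes "C \<subseteq> {1..n}" "i \<in> {1..n}"
  shows "x i \<in> cover_of C \<longleftrightarrow> i \<notin> C"
proof -
  have "x i \<notin> y ` C" using x_neq_y[OF assms(2)] assms(1) by (metis imageE subsetD)
  moreover have "x i \<in> x ` ({1..n} - C) \<longleftrightarrow> i \<in> {1..n} - C"
    by (rule inj_on_image_mem_iff[OF inj_x assms(2)]) simp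
  ultimately show ?thesis using assms(2) by (simp add: cover_of_def)
qed

lemma y_in_cover_of:
  assumes "C \<subseteq> {1..n}" "i \<in> {1..n}"
  shows "y i \<in> cover_of C \<longleftrightarrow> i \<in> C"
proof -
  have "y i \<notin> x ` ({1..n} - C)"
  proof
    assume "y i \<in> x ` ({1..n} - C)"
    then obtain j where "j \<in> {1..n}" "y i = x j" by blast
    then show False using x_neq_y[of j i] assms(2) by simp
  qed
  moreover have "y i \<in> y ` C \<longleftrightarrow> i \<in> C"
    by (rule inj_on_image_mem_iff[OF inj_y assms(2,1)])
  ultimately show ?thesis by (simp add: cover_of_def)
qed

lemma card_cover_of: "C \<subseteq> {1..n} \<Longrightarrow> card (cover_of C) = n"
proof -
  assume C: "C \<subseteq> {1..n}"
  have "y ` C \<inter> x ` ({1..n} - C) = {}"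
    using labelling_conditions(3) image_mono[OF C, of y] image_mono[of "{1..n} - C" "{1..n}" x] by blast
  then have "card (cover_of C) = card (y ` C) + card (x ` ({1..n} - C))"
    unfolding cover_of_def by (intro card_Un_disjoint) auto
  also have "card (y ` C) = card C" using inj_on_subset[OF inj_y C] by (rule card_image)
  also have "card (x ` ({1..n} - C)) = card ({1..n} - C)"
    using inj_on_subset[OF inj_x] by (intro card_image) auto
  also have "card ({1..n} - C) = n - card C"
    using C by (simp add: card_Diff_subset finite_subset)
  also have "card C + (n - card C) = n" using card_mono[OF _ C] by simp
  finally show ?thesis .
qed

text \<open>\<open>cover_of C\<close> contains only one end of each matching edge, so dropping any
  vertex uncovers the matching edge at that vertex.\<close>

lemma cover_of_minimal:
  assumes C: "C \<subseteq> {1..n}" and cover: "vertex_cover E (cover_of C)"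
  shows "cover_of C \<in> min_vertex_covers E"
  unfolding min_vertex_covers_def
proof (intro CollectI conjI cover allI impI notI)
  fix D assume D: "D \<subset> cover_of C" "vertex_cover E D"
  then obtain v where v: "v \<in> cover_of C" "v \<notin> D" by blast
  obtain i where i: "i \<in> {1..n}" "v = x i \<or> v = y i" using vertices by blast
  have "{x i, y i} \<inter> D \<noteq> {}" using D(2) matching[OF i(1)]
      unfolding vertex_cover_def by (rule bspec)
  then show False
    using v i D(1) x_in_cover_of[OF C i(1)] y_in_cover_of[OF C i(1)] by blast
qed

text \<open>Unmixedness forces a minimal vertex cover, which meets each matching edge, to meet it in exactly
  one vertex.\<close>

lemma min_vertex_cover_cover_of:
  assumes "D \<in> min_vertex_covers E"
  shows "\<exists>C\<in>cover_family. D = cover_of C"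
proof
  define C where "C = {i\<in>{1..n}. y i \<in> D}"
  have C: "C \<subseteq> {1..n}" by (auto simp: C_def)
  have cover: "vertex_cover E D" using assms by (simp add: min_vertex_covers_def)
  have "x i \<in> D" if "i \<in> {1..n}" "i \<notin> C" for i
  proof -
    have "{x i, y i} \<inter> D \<noteq> {}" using cover matching[OF that(1)]
      unfolding vertex_cover_def by (rule bspec)
    then show ?thesis using that by (auto simp: C_def)
  qed
  moreover have "y i \<in> D" if "i \<in> C" for i using that by (simp add: C_def)
  ultimately have sub: "cover_of C \<subseteq> D" unfolding cover_of_def by blast
  have "card D = card (x ` {1..n})"
    using unmixed assms x_min_cover unfolding unmixed_def by blast
  then have "card D = card (cover_of C)" using card_cover_of[OF C] card_image[OF inj_x] by simp
  then show D: "D = cover_of C" using card_subset_eq[OF _ sub] by auto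
  show "C \<in> cover_family" using C cover unfolding D[symmetric] by (simp add: cover_family_def D[symmetric])
qed

lemma inj_cover_of: "inj_on cover_of cover_family"
proof (rule inj_onI)
  fix C D assume CD: "C \<in> cover_family" "D \<in> cover_family" "cover_of C = cover_of D"
  then have C: "C \<subseteq> {1..n}" and D: "D \<subseteq> {1..n}" by (auto simp: cover_family_def)
  have eq: "B = {i\<in>{1..n}. y i \<in> cover_of B}" if "B \<subseteq> {1..n}" for B
    using that y_in_cover_of[OF that] by auto
  have "C = {i\<in>{1..n}. y i \<in> cover_of D}" using eq[OF C] unfolding CD(3) .
  also have "\<dots> = D" by (rule eq[OF D, symmetric])
  finally show "C = D" .
qed

lemma min_vertex_covers_eq: "min_vertex_covers E = cover_of ` cover_family"
  using min_vertex_cover_cover_of cover_of_minimal by (auto simp: cover_family_def)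

lemma edge_cases:
  assumes "e \<in> E"
  obtains i j where "i \<in> {1..n}" "j \<in> {1..n}" "e = {x i, y j} \<or> e = {x i, x j}"
proof -
  obtain u v where e: "e = {u, v}"
    using assms simple unfolding simple_graph_def by (metis card_2_iff)
  have "\<not> e \<subseteq> y ` {1..n}" using y_independent assms by (simp add: independent_set_def)
  then have "u \<in> x ` {1..n} \<or> v \<in> x ` {1..n}" using vertices e by blast
  then obtain w z where "e = {w, z}" "w \<in> x ` {1..n}" using e by blast
  moreover have "z \<in> x ` {1..n} \<or> z \<in> y ` {1..n}" using vertices by blast
  ultimately show thesis using that by blast
qed

lemma cover_family_iff:
  "C \<in> cover_family \<longleftrightarrow> C \<subseteq> {1..n} \<and>
    (\<forall>i\<in>{1..n}. \<forall>j\<in>{1..n}. ({x i, y j} \<in> E \<longrightarrow> i \<in> C \<longrightarrow> j \<in> C) \<and>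
      ({x i, x j} \<in> E \<longrightarrow> i \<notin> C \<or> j \<notin> C))"
proof (cases "C \<subseteq> {1..n}")
  case C: True
  note xy = x_in_cover_of[OF C] y_in_cover_of[OF C]
  have "vertex_cover E (cover_of C) \<longleftrightarrow>
    (\<forall>i\<in>{1..n}. \<forall>j\<in>{1..n}. ({x i, y j} \<in> E \<longrightarrow> i \<in> C \<longrightarrow> j \<in> C) \<and>
      ({x i, x j} \<in> E \<longrightarrow> i \<notin> C \<or> j \<notin> C))" (is "?L \<longleftrightarrow> ?R")
  proof
    assume L: ?L
    show ?R
    proof (intro ballI conjI impI)
      fix i j assume ij: "i \<in> {1..n}" "j \<in> {1..n}"
      show "j \<in> C" if e: "{x i, y j} \<in> E" "i \<in> C"
      proof -
        have "{x i, y j} \<inter> cover_of C \<noteq> {}" using L e(1)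
      unfolding vertex_cover_def by (rule bspec)
        then show ?thesis using xy(1)[OF ij(1)] xy(2)[OF ij(2)] e(2) by blast
      qed
      show "i \<notin> C \<or> j \<notin> C" if e: "{x i, x j} \<in> E"
      proof -
        have "{x i, x j} \<inter> cover_of C \<noteq> {}" using L e
      unfolding vertex_cover_def by (rule bspec)
        then show ?thesis using xy(1)[OF ij(1)] xy(1)[OF ij(2)] by blast
      qed
    qed
  next
    assume R: ?R
    show ?L unfolding vertex_cover_def
    proof
      fix e assume e: "e \<in> E"
      obtain i j where ij: "i \<in> {1..n}" "j \<in> {1..n}" "e = {x i, y j} \<or> e = {x i, x j}"
        using edge_cases[OF e] by blast
      have "x i \<in> cover_of C \<or> (e = {x i, y j} \<and> y j \<in> cover_of C) \<or> (e = {x i, x j} \<and> x j \<in> cover_of C)"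
        using R ij e xy(1)[OF ij(1)] xy(1)[OF ij(2)] xy(2)[OF ij(2)] by metis
      then show "e \<inter> cover_of C \<noteq> {}" using ij(3) by blast
    qed
  qed
  then show ?thesis using C by (simp add: cover_family_def)
qed (simp add: cover_family_def)

text \<open>\<open>C - {s} - {t}\<close> is the intersection of \<open>C - {s}\<close> and
  \<open>C - {t}\<close>, and both kinds of conditions in \<open>cover_family_iff\<close> pass to
  intersections.\<close>

lemma cover_family_cube:
  assumes "C \<in> cover_family" "s \<in> exchange_set cover_family C" "t \<in> exchange_set cover_family C"
  shows "C - {s} - {t} \<in> cover_family"
  using assms unfolding exchange_set_def cover_family_iff by blast

text \<open>The exchangeable index is the smallest element of \<open>C - D\<close>: by condition (iii) of a standard
  labelling a vertex \<open>y s\<close> is only adjacent to \<open>x i\<close> with \<open>i \<le> s\<close>.\<close>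

lemma cover_family_exchange:
  assumes C: "C \<in> cover_family" and D: "D \<in> cover_family" and "\<not> C \<subseteq> D"
  obtains s where "s \<in> exchange_set cover_family C" "s \<notin> D"
proof -
  define s where "s = Min (C - D)"
  have Cn: "C \<subseteq> {1..n}" and Dn: "D \<subseteq> {1..n}" using C D by (auto simp: cover_family_def)
  have fin: "finite (C - D)" using Cn finite_subset by blast
  have s: "s \<in> C" "s \<notin> D" using Min_in[OF fin] assms(3) unfolding s_def by auto
  have least: "i \<in> D" if "i \<in> C" "i < s" for i
    using that Min_le[OF fin, of i] unfolding s_def by force
  have closed: "j \<noteq> s" if ij: "i \<in> {1..n}" "j \<in> {1..n}" "{x i, y j} \<in> E" "i \<in> C" "i \<noteq> s" for i j
  proof
    assume j: "j = s"
    have "i < s" using edge_le[OF ij(1-3)] ij(5) j by simp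
    then have "i \<in> D" using least ij(4) by blast
    then show False using D ij(1-3) s(2) j unfolding cover_family_iff by blast
  qed
  \<comment> \<open>Removing \<open>s\<close> can only violate an edge between \<open>y s\<close>
    and some \<open>x i\<close> with \<open>i\<close> still in the set, which \<open>closed\<close>
    rules out.\<close>
  have "C - {s} \<in> cover_family"
    using C closed unfolding cover_family_iff by blast
  then show thesis using that s by (simp add: exchange_set_def)
qed

lemma cover_of_Diff:
  assumes "C \<subseteq> {1..n}" "s \<in> C"
  shows "cover_of (C - {s}) = cover_of C - {y s} \<union> {x s}"
proof -
  have "y s \<notin> x ` ({1..n} - C)"
  proof
    assume "y s \<in> x ` ({1..n} - C)"
    then obtain j where j: "j \<in> {1..n}" "y s = x j" by blast
    have "s \<in> {1..n}" using assms by blast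
    then show False using x_neq_y[OF j(1)] j(2) by metis
  qed
  moreover have "y ` (C - {s}) = y ` C - y ` {s}"
    by (rule inj_on_image_set_diff[OF inj_y]) (use assms in auto)
  moreover have "{1..n} - (C - {s}) = insert s ({1..n} - C)" using assms by blast
  ultimately show ?thesis unfolding cover_of_def by auto
qed

lemma card_cover_exchanges:
  assumes C: "C \<in> cover_family"
  shows "card (cover_exchanges E n x y (cover_of C)) = card (exchange_set cover_family C)"
proof -
  have Cn: "C \<subseteq> {1..n}" using C by (simp add: cover_family_def)
  have "s \<in> {1..n} \<and> y s \<in> cover_of C \<and> cover_of C - {y s} \<union> {x s} \<in> min_vertex_covers E \<longleftrightarrow>
    s \<in> exchange_set cover_family C" for s
  proof (cases "s \<in> C")
    case True
    have "cover_of (C - {s}) \<in> min_vertex_covers E \<longleftrightarrow> C - {s} \<in> cover_family"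
      using Cn cover_of_minimal[of "C - {s}"] by (auto simp: cover_family_def min_vertex_covers_def)
    then show ?thesis
      using True Cn y_in_cover_of[OF Cn] cover_of_Diff[OF Cn True] by (auto simp: exchange_set_def)
  next
    case False
    then show ?thesis using y_in_cover_of[OF Cn] by (auto simp: exchange_set_def)
  qed
  then have "cover_exchanges E n x y (cover_of C) = x ` exchange_set cover_family C"
    unfolding cover_exchanges_def by blast
  moreover have "inj_on x (exchange_set cover_family C)"
    using Cn by (intro inj_on_subset[OF inj_x]) (auto simp: exchange_set_def)
  ultimately show ?thesis by (simp add: card_image)
qed

end

section \<open>The covers as a regular cubical family\<close>

context unmixed_labelled_graph
begin

abbreviation cover_exp :: "nat set \<Rightarrow> 'v \<Rightarrow>\<^sub>0 nat" where
  "cover_exp C \<equiv> squarefree_exp (cover_of C)"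

lemma lookup_cover_exp_x:
  "C \<in> cover_family \<Longrightarrow> s \<in> {1..n} \<Longrightarrow> Poly_Mapping.lookup (cover_exp C) (x s) = (if s \<in> C then 0 else 1)"
  using x_in_cover_of by (simp add: lookup_squarefree_exp cover_family_def)

lemma gen_eq_monomial:
  assumes "C \<subseteq> {1..n}"
  shows "(\<Prod>s\<in>C. var (y s)) * (\<Prod>s\<in>{1..n} - C. var (x s)) =
    (Poly_Mapping.single (cover_exp C) 1 :: ('v, 'k::field) mpoly)"
proof -
  have "inj_on y C" "inj_on x ({1..n} - C)"
    using assms inj_on_subset[OF inj_y] inj_on_subset[OF inj_x] by auto
  moreover have "y ` C \<inter> x ` ({1..n} - C) = {}"
    using labelling_conditions(3) image_mono[OF assms, of y]
      image_mono[of "{1..n} - C" "{1..n}" x] by blast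
  ultimately have "(\<Prod>s\<in>C. var (y s)) * (\<Prod>s\<in>{1..n} - C. var (x s)) =
    (\<Prod>v\<in>cover_of C. var v :: ('v, 'k) mpoly)"
    unfolding cover_of_def by (subst prod.union_disjoint) (simp_all add: prod.reindex)
  then show ?thesis by (simp only: prod_var)
qed

text \<open>Both algebraic axioms become divisibility statements about single monomials. For
  regularity: if \<open>x t\<close> divides \<open>x s\<close> times a monomial and \<open>t\<close>
  differs from \<open>s\<close>, then it divides the monomial.\<close>

lemma regular_cubical_family_cover_family:
  "regular_cubical_family {1..n} cover_family (\<lambda>s. var (x s) :: ('v, 'k::field) mpoly) (\<lambda>s. var (y s))"
proof -
  have cub: "cubical_family {1..n} cover_family"
    by unfold_locales (use cover_family_cube in \<open>auto simp: cover_family_def\<close>)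
  interpret cubical_family "{1..n}" cover_family
    "\<lambda>s. var (x s) :: ('v, 'k) mpoly" "\<lambda>s. var (y s)" by (rule cub)
  show ?thesis
  proof unfold_locales
    fix V s and w :: "('v, 'k) mpoly"
    assume V: "V \<subseteq> {1..n}" "s \<in> {1..n} - V"
      and "\<exists>b. var (x s) * w = (\<Sum>t\<in>V. var (x t) * b t)"
    then obtain b where b: "Poly_Mapping.single (Poly_Mapping.single (x s) 1) 1 * w =
      (\<Sum>t\<in>V. Poly_Mapping.single (Poly_Mapping.single (x t) 1) 1 * b t)"
      unfolding var_def by blast
    show "\<exists>b. w = (\<Sum>t\<in>V. var (x t) * b t)"
    proof (rule in_variable_ideal)
      show "finite V" using V(1) finite_subset by blast
      fix k assume "k \<in> Poly_Mapping.keys w"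
      from b this obtain t where t: "t \<in> V"
        "\<And>v. Poly_Mapping.lookup (Poly_Mapping.single (x t) (1::nat)) v \<le>
          Poly_Mapping.lookup (Poly_Mapping.single (x s) 1) v + Poly_Mapping.lookup k v"
        by (rule monomial_quotient_keys) (rule that)
      have "x s \<noteq> x t" using inj_x V t(1) by (auto dest: inj_onD)
      then have "Poly_Mapping.lookup k (x t) > 0"
        using t(2)[of "x t"] by (simp add: lookup_single when_def)
      then show "\<exists>t\<in>V. Poly_Mapping.lookup k (x t) > 0" using t(1) by blast
    qed
  next
    fix C G and a :: "('v, 'k) mpoly" and c
    assume C: "C \<in> cover_family" and G: "G \<subseteq> cover_family" and not_le: "\<And>D. D \<in> G \<Longrightarrow> \<not> C \<subseteq> D"
      and eq: "gen C * a = (\<Sum>D\<in>G. gen D * c D)"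
    have sub: "D \<subseteq> {1..n}" if "D \<in> cover_family" for D using that by (simp add: cover_family_def)
    have gen: "gen D = Poly_Mapping.single (cover_exp D) 1" if "D \<in> cover_family" for D
      unfolding gen_def by (rule gen_eq_monomial[OF sub[OF that]])
    have eq': "Poly_Mapping.single (cover_exp C) 1 * a =
      (\<Sum>D\<in>G. Poly_Mapping.single (cover_exp D) 1 * c D)"
      unfolding gen[OF C, symmetric] eq using gen G by (intro sum.cong) auto
    show "\<exists>b. a = (\<Sum>s\<in>exchange_set cover_family C. var (x s) * b s)"
    proof (rule in_variable_ideal)
      show "finite (exchange_set cover_family C)"
        using exchange_set_subset[OF C] finite_subset by blast
      fix k assume "k \<in> Poly_Mapping.keys a"
      from eq' this obtain D where D: "D \<in> G"
        "\<And>v. Poly_Mapping.lookup (cover_exp D) v \<le>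
          Poly_Mapping.lookup (cover_exp C) v + Poly_Mapping.lookup k v"
        by (rule monomial_quotient_keys) (rule that)
      have DF: "D \<in> cover_family" using D(1) G by blast
      \<comment> \<open>The generator of \<open>D\<close> contains \<open>x s\<close> and that of
        \<open>C\<close> does not. As the former divides the latter times the monomial
        \<open>k\<close>, the exchangeable variable \<open>x s\<close> divides
        \<open>k\<close>.\<close>
      obtain s where s: "s \<in> exchange_set cover_family C" "s \<notin> D"
        by (rule cover_family_exchange[OF C DF not_le[OF D(1)]])
      have sn: "s \<in> {1..n}" using s(1) exchange_set_subset[OF C] by blast
      have "s \<in> C" using s(1) by (simp add: exchange_set_def)
      then have "Poly_Mapping.lookup k (x s) > 0"
        using D(2)[of "x s"] lookup_cover_exp_x[OF C sn] lookup_cover_exp_x[OF DF sn] s(2) by simp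
      then show "\<exists>t\<in>exchange_set cover_family C. Poly_Mapping.lookup k (x t) > 0"
        using s(1) by blast
    qed
  qed
qed

end

section \<open>Minimal graded free resolutions\<close>

text \<open>Entries of the differentials are linear forms or zero. This single fact
  \<open>keys\<close> yields both the shifts \<open>n + i\<close>, starting from generators of
  degree \<open>n\<close>, and minimality.\<close>

lemma minimal_graded_free_resolution_diff_mat:
  fixes I :: "('v::finite, 'k::field) mpoly set"
  assumes "regular_cubical_family N F (\<lambda>s. var (x s) :: ('v, 'k) mpoly) (\<lambda>s. var (y s))"
    and I: "I = {\<Sum>C\<in>F. cubical_family.gen N (\<lambda>s. var (x s)) (\<lambda>s. var (y s)) C * c C | c. True}"
    and deg: "\<And>C. C \<in> F \<Longrightarrow> homogeneous (int n) (cubical_family.gen N (\<lambda>s. var (x s) :: ('v, 'k) mpoly) (\<lambda>s. var (y s)) C)"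
  shows "minimal_graded_free_resolution I
    (\<lambda>i. replicate (\<Sum>C\<in>F. card (exchange_set F C) choose i) (int (n + i)))
    (regular_cubical_family.diff_mat N F (\<lambda>s. var (x s)) (\<lambda>s. var (y s)))"
proof -
  interpret regular_cubical_family N F "\<lambda>s. var (x s) :: ('v, 'k) mpoly" "\<lambda>s. var (y s)" by fact
  have keys: "Poly_Mapping.keys (diff_mat (Suc i) $$ (p, q)) \<subseteq> {m. mon_degree m = 1}"
    if pq: "p < rank i" "q < rank (Suc i)" for i p q
  proof -
    have var: "Poly_Mapping.keys (koszul_sign s T * z * unit_chain b C' T' :: ('v, 'k) mpoly) \<subseteq> {m. mon_degree m = 1}"
      if "Poly_Mapping.keys z \<subseteq> {m. mon_degree m = 1}" for s T z b C' T'
    proof -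
      have "koszul_sign s T = (1 :: ('v, 'k) mpoly) \<or> koszul_sign s T = (- 1 :: ('v, 'k) mpoly)"
        unfolding koszul_sign_def by (metis minus_one_power_iff)
      then show ?thesis using that by (auto simp: unit_chain_def keys_minus)
    qed
    have "mon_degree (Poly_Mapping.single v 1) = 1" for v :: 'v
      by (simp add: mon_degree_def lookup_single when_def)
    then have v: "Poly_Mapping.keys (var v :: ('v, 'k) mpoly) \<subseteq> {m. mon_degree m = 1}"
      "Poly_Mapping.keys (- var v :: ('v, 'k) mpoly) \<subseteq> {m. mon_degree m = 1}" for v
      by (auto simp: var_def)
    have vz: "Poly_Mapping.keys (if P then var v else - var w :: ('v, 'k) mpoly) \<subseteq> {m. mon_degree m = 1}"
      for P v w using v by simp
    have "diff_mat (Suc i) $$ (p, q) = bdry (unit_chain (enum (Suc i) q)) (fst (enum i p)) (snd (enum i p))"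
      using pq by (simp add: diff_mat_def)
    then show ?thesis
      unfolding cube_diff_def by (simp only:) (rule order_trans[OF keys_sum], rule UN_least, rule var, rule vz)
  qed
  show ?thesis
    unfolding minimal_graded_free_resolution_def length_replicate rank_eq[symmetric]
  proof (intro conjI allI impI ballI)
    show "resolution I rank (\<lambda>i. carrier_vec (rank i)) diff_mat"
      by (rule resolution_diff_mat[OF I])
    show "int (mon_degree m) = replicate (rank 0) (int (n + 0)) ! q"
      if "q < rank 0" "m \<in> Poly_Mapping.keys (diff_mat 0 $$ (0, q))" for q m
    proof -
      have "fst (enum 0 q) \<in> F" using enum_in_basis[OF that(1)] by (auto simp: basis_def)
      then show ?thesis using deg that by (simp add: diff_mat_def homogeneous_def)
    qed
    show "int (mon_degree m) = replicate (rank (Suc i)) (int (n + Suc i)) ! q - replicate (rank i) (int (n + i)) ! p"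
      if "p < rank i" "q < rank (Suc i)" "m \<in> Poly_Mapping.keys (diff_mat (Suc i) $$ (p, q))" for i p q m
      using keys[OF that(1,2)] that by auto
    show "Poly_Mapping.lookup (diff_mat (Suc i) $$ (p, q)) 0 = 0"
      if "p < rank i" "q < rank (Suc i)" for i p q
    proof (rule ccontr)
      assume "Poly_Mapping.lookup (diff_mat (Suc i) $$ (p, q)) 0 \<noteq> 0"
      then have "0 \<in> Poly_Mapping.keys (diff_mat (Suc i) $$ (p, q))" by (simp add: in_keys_iff)
      then have "mon_degree (0 :: 'v \<Rightarrow>\<^sub>0 nat) = 1" using keys[OF that] by blast
      then show False by (simp add: mon_degree_def)
    qed
  qed
qed

section \<open>Degree-preserving matrices and uniqueness of shifts\<close>

definition graded_mat :: "int list \<Rightarrow> int list \<Rightarrow> ('v::finite, 'k::field) mpoly mat \<Rightarrow> bool" where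
  "graded_mat b c M \<longleftrightarrow> (\<forall>p<length b. \<forall>q<length c. homogeneous (c ! q - b ! p) (M $$ (p, q)))"

text \<open>The degree 0 component of a linear map between free modules with shifts \<open>c\<close>
  (source) and \<open>b\<close> (target). The augmentation fits in with target shifts
  \<open>[0]\<close>.\<close>

definition degree_part_mat :: "int list \<Rightarrow> int list \<Rightarrow> ('v::finite, 'k::field) mpoly mat \<Rightarrow> ('v, 'k) mpoly mat" where
  "degree_part_mat b c M =
     mat (length b) (length c) (\<lambda>(p, q). degree_part (c ! q - b ! p) (M $$ (p, q)))"

lemma degree_part_mat_carrier: "degree_part_mat b c M \<in> carrier_mat (length b) (length c)"
  by (simp add: degree_part_mat_def)

lemma degree_part_mat_graded:
  assumes "graded_mat b c M" "M \<in> carrier_mat (length b) (length c)"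
  shows "degree_part_mat b c M = M"
proof (rule eq_matI)
  fix p q assume "p < dim_row M" "q < dim_col M"
  then have pq: "p < length b" "q < length c" using assms(2) by auto
  then have "homogeneous (c ! q - b ! p) (M $$ (p, q))" using assms(1) by (simp add: graded_mat_def)
  then show "degree_part_mat b c M $$ (p, q) = M $$ (p, q)"
    using pq by (simp add: degree_part_mat_def degree_part_homogeneous)
qed (use assms(2) in \<open>auto simp: degree_part_mat_def\<close>)

lemma degree_part_mat_mult_left:
  assumes "graded_mat b c M" "M \<in> carrier_mat (length b) (length c)"
    and "N \<in> carrier_mat (length c) (length d)"
  shows "degree_part_mat b d (M * N) = M * degree_part_mat c d N"
proof (rule eq_matI)
  fix p q assume "p < dim_row (M * degree_part_mat c d N)" "q < dim_col (M * degree_part_mat c d N)"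
  then have pq: "p < length b" "q < length d" using assms(2) by (auto simp: degree_part_mat_def)
  have "degree_part_mat b d (M * N) $$ (p, q) =
    (\<Sum>k<length c. degree_part (d ! q - b ! p) (M $$ (p, k) * N $$ (k, q)))"
    using pq assms(2,3)
    by (simp add: degree_part_mat_def scalar_prod_def degree_part_sum lessThan_atLeast0)
  also have "\<dots> = (\<Sum>k<length c. M $$ (p, k) * degree_part (d ! q - c ! k) (N $$ (k, q)))"
  proof (rule sum.cong)
    fix k assume "k \<in> {..<length c}"
    then have "homogeneous (c ! k - b ! p) (M $$ (p, k))" using assms(1) pq by (simp add: graded_mat_def)
    from degree_part_mult_left[OF this, of "d ! q - b ! p" "N $$ (k, q)"]
    show "degree_part (d ! q - b ! p) (M $$ (p, k) * N $$ (k, q)) =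
      M $$ (p, k) * degree_part (d ! q - c ! k) (N $$ (k, q))" by simp
  qed simp
  also have "\<dots> = (M * degree_part_mat c d N) $$ (p, q)"
    using pq assms(2) by (simp add: degree_part_mat_def scalar_prod_def lessThan_atLeast0)
  finally show "degree_part_mat b d (M * N) $$ (p, q) = (M * degree_part_mat c d N) $$ (p, q)" .
qed (use assms in \<open>auto simp: degree_part_mat_def\<close>)

lemma degree_part_mat_mult_right:
  assumes "graded_mat c d N" "N \<in> carrier_mat (length c) (length d)"
    and "M \<in> carrier_mat (length b) (length c)"
  shows "degree_part_mat b d (M * N) = degree_part_mat b c M * N"
proof (rule eq_matI)
  fix p q assume "p < dim_row (degree_part_mat b c M * N)" "q < dim_col (degree_part_mat b c M * N)"
  then have pq: "p < length b" "q < length d" using assms(2) by (auto simp: degree_part_mat_def)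
  have "degree_part_mat b d (M * N) $$ (p, q) =
    (\<Sum>k<length c. degree_part (d ! q - b ! p) (M $$ (p, k) * N $$ (k, q)))"
    using pq assms(2,3)
    by (simp add: degree_part_mat_def scalar_prod_def degree_part_sum lessThan_atLeast0)
  also have "\<dots> = (\<Sum>k<length c. degree_part (c ! k - b ! p) (M $$ (p, k)) * N $$ (k, q))"
  proof (rule sum.cong)
    fix k assume "k \<in> {..<length c}"
    then have "homogeneous (d ! q - c ! k) (N $$ (k, q))" using assms(1) pq by (simp add: graded_mat_def)
    from degree_part_mult_right[OF this, of "d ! q - b ! p" "M $$ (p, k)"]
    show "degree_part (d ! q - b ! p) (M $$ (p, k) * N $$ (k, q)) =
      degree_part (c ! k - b ! p) (M $$ (p, k)) * N $$ (k, q)" by simp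
  qed simp
  also have "\<dots> = (degree_part_mat b c M * N) $$ (p, q)"
    using pq assms(2) by (simp add: degree_part_mat_def scalar_prod_def lessThan_atLeast0)
  finally show "degree_part_mat b d (M * N) $$ (p, q) = (degree_part_mat b c M * N) $$ (p, q)" .
qed (use assms in \<open>auto simp: degree_part_mat_def\<close>)

abbreviation const_term :: "('v::finite, 'k::field) mpoly \<Rightarrow> 'k" where
  "const_term f \<equiv> Poly_Mapping.lookup f 0"

lemma minimal_graded_free_resolutionD:
  assumes "minimal_graded_free_resolution I d A"
  shows "resolution I (\<lambda>i. length (d i)) (\<lambda>i. carrier_vec (length (d i))) A"
    and "graded_mat [0] (d 0) (A 0)"
    and "graded_mat (d i) (d (Suc i)) (A (Suc i))"
    and "map_mat const_term (A (Suc i)) = 0\<^sub>m (length (d i)) (length (d (Suc i)))"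
proof -
  show R: "resolution I (\<lambda>i. length (d i)) (\<lambda>i. carrier_vec (length (d i))) A"
    using assms by (simp add: minimal_graded_free_resolution_def)
  show "graded_mat [0] (d 0) (A 0)" "graded_mat (d i) (d (Suc i)) (A (Suc i))"
    using assms by (simp_all add: minimal_graded_free_resolution_def graded_mat_def homogeneous_def)
  have "\<forall>i. \<forall>p<length (d i). \<forall>q<length (d (Suc i)). const_term (A (Suc i) $$ (p, q)) = 0"
    using assms unfolding minimal_graded_free_resolution_def by (elim conjE)
  then show "map_mat const_term (A (Suc i)) = 0\<^sub>m (length (d i)) (length (d (Suc i)))"
    using resolutionD(3)[OF R, of i] by (intro eq_matI) auto
qed

text \<open>The comparison map from a linear resolution can be replaced by its component of degree 0. Modulo the
  maximal ideal it stays invertible, so each of its rows has a nonzero constant entry, which forces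
  the shift of that row.\<close>

lemma minimal_shifts_unique:
  fixes I :: "('v::finite, 'k::field) mpoly set"
  assumes F: "minimal_graded_free_resolution I (\<lambda>i. replicate (r i) (s i)) A"
    and F': "minimal_graded_free_resolution I d' A'"
  shows "d' i = replicate (r i) (s i)"
proof -
  define d where "d i = replicate (r i) (s i)" for i
  note D = minimal_graded_free_resolutionD[OF F, folded d_def]
  note D' = minimal_graded_free_resolutionD[OF F']
  note hom = comm_ring_hom_lookup_0
  obtain f where f: "\<And>i. f i \<in> carrier_mat (length (d' i)) (length (d i))" "A' 0 * f 0 = A 0"
    "\<And>i. A' (Suc i) * f (Suc i) = f i * A (Suc i)"
    by (rule free_comparison_map[OF D(1) D'(1)]) (rule that)
  obtain g where g: "\<And>i. g i \<in> carrier_mat (length (d i)) (length (d' i))" "A 0 * g 0 = A' 0"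
    "\<And>i. A (Suc i) * g (Suc i) = g i * A' (Suc i)"
    by (rule free_comparison_map[OF D'(1) D(1)]) (rule that)
  \<comment> \<open>The differentials have degree 0, so the commutation relations of
    \<open>f\<close> persist for its degree 0 component. Only \<open>f\<close> needs this treatment;
    \<open>g\<close> may stay inhomogeneous.\<close>
  define f' where "f' i = degree_part_mat (d' i) (d i) (f i)" for i
  have A0: "A 0 \<in> carrier_mat (length [0::int]) (length (d 0))"
    "A' 0 \<in> carrier_mat (length [0::int]) (length (d' 0))"
    using resolutionD(2)[OF D(1)] resolutionD(2)[OF D'(1)] by simp_all
  note AS = resolutionD(3)[OF D(1)] resolutionD(3)[OF D'(1)]
  have f': "f' i \<in> carrier_mat (length (d' i)) (length (d i))" for i
    by (simp add: f'_def degree_part_mat_carrier)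
  have f'0: "A' 0 * f' 0 = A 0"
    unfolding f'_def degree_part_mat_mult_left[OF D'(2) A0(2) f(1), symmetric] f(2)
    by (rule degree_part_mat_graded[OF D(2) A0(1)])
  have f'S: "A' (Suc i) * f' (Suc i) = f' i * A (Suc i)" for i
    unfolding f'_def degree_part_mat_mult_left[OF D'(3) AS(2) f(1), symmetric] f(3)
    by (rule degree_part_mat_mult_right[OF D(3) AS(1) f(1)])
  have gf: "map_mat const_term (g i) * map_mat const_term (f' i) = 1\<^sub>m (length (d i))"
    by (rule minimal_comparison_inverse[OF D(1) hom D(4) D'(1) f' f'0 f'S g])
  have fg: "map_mat const_term (f' i) * map_mat const_term (g i) = 1\<^sub>m (length (d' i))"
    by (rule minimal_comparison_inverse[OF D'(1) hom D'(4) D(1) g f' f'0 f'S])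
  have c: "map_mat const_term (g i) \<in> carrier_mat (length (d i)) (length (d' i))"
    "map_mat const_term (f' i) \<in> carrier_mat (length (d' i)) (length (d i))"
    using g(1)[of i] f'[of i] by auto
  have len: "length (d' i) = r i"
    using mat_left_inverse_dim_le[OF c(2) c(1) gf] mat_left_inverse_dim_le[OF c(1) c(2) fg]
    by (simp add: d_def)
  moreover have "d' i ! p = s i" if p: "p < r i" for p
  proof -
    have "(map_mat const_term (f' i) * map_mat const_term (g i)) $$ (p, p) = 1"
      unfolding fg using p len by simp
    moreover have "(map_mat const_term (f' i) * map_mat const_term (g i)) $$ (p, p) =
      (\<Sum>q<r i. map_mat const_term (f' i) $$ (p, q) * map_mat const_term (g i) $$ (q, p))"
      using p len c by (simp add: scalar_prod_def lessThan_atLeast0 d_def)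
    ultimately have "\<exists>q<r i. map_mat const_term (f' i) $$ (p, q) \<noteq> 0"
      by (metis (no_types, lifting) lessThan_iff mult_zero_left sum.neutral zero_neq_one)
    then obtain q where q: "q < r i" "map_mat const_term (f' i) $$ (p, q) \<noteq> 0" by blast
    have "const_term (degree_part (s i - d' i ! p) (f i $$ (p, q))) \<noteq> 0"
      using q p len by (simp add: f'_def degree_part_mat_def d_def)
    then show ?thesis using homogeneous_degree_eq_0[OF homogeneous_degree_part] by fastforce
  qed
  ultimately show ?thesis by (intro nth_equalityI) auto
qed

text \<open>Existence makes the chosen \<open>minimal_shifts I\<close> the shifts of some minimal
  resolution, and uniqueness identifies them. Equality of lists is attainable because every list is
  constant.\<close>

lemma minimal_shifts_eq:
  assumes "minimal_graded_free_resolution I (\<lambda>i. replicate (r i) (s i)) A"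
  shows "minimal_shifts I = (\<lambda>i. replicate (r i) (s i))"
proof -
  have "\<exists>A. minimal_graded_free_resolution I (minimal_shifts I) A"
    unfolding minimal_shifts_def
    by (rule someI_ex[of "\<lambda>d. \<exists>A. minimal_graded_free_resolution I d A"]) (use assms in blast)
  then show ?thesis using minimal_shifts_unique[OF assms] by blast
qed

section \<open>Projective dimension from a minimal resolution\<close>

lemma projective_summand_carrier_vec: "projective_summand r (carrier_vec r)"
  unfolding projective_summand_iff using idempotent_one_mat mat_image_one by metis

lemma carrier_vec_0: "carrier_vec 0 = {0\<^sub>v 0 :: 'a::zero vec}"
  by auto

text \<open>The minimal resolution itself gives the upper bound. A projective resolution ending
  before degree \<open>l\<close> would be zero there, forcing \<open>r l = 0\<close>.\<close>

lemma projective_dimension_eq: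
  fixes I :: "('v::finite, 'k::field) mpoly set"
  assumes F: "minimal_graded_free_resolution I (\<lambda>i. replicate (r i) (s i)) A"
    and l: "r l \<noteq> 0" "\<And>i. i > l \<Longrightarrow> r i = 0"
  shows "projective_dimension I = enat l"
  unfolding projective_dimension_def
proof (rule antisym)
  note D = minimal_graded_free_resolutionD[OF F, unfolded length_replicate]
  show "Inf {enat l | l. \<exists>r P A. resolution I r P A \<and> (\<forall>i. projective_summand (r i) (P i)) \<and>
    (\<forall>i>l. P i = {0\<^sub>v (r i)})} \<le> enat l"
  proof (rule Inf_lower, intro CollectI exI conjI allI impI)
    show "resolution I r (\<lambda>i. carrier_vec (r i)) A" by (rule D(1))
    show "projective_summand (r i) (carrier_vec (r i))" for i by (rule projective_summand_carrier_vec)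
    show "carrier_vec (r i) = {0\<^sub>v (r i)}" if "i > l" for i using l(2)[OF that] carrier_vec_0 by simp
  qed simp
  show "enat l \<le> Inf {enat l | l. \<exists>r P A. resolution I r P A \<and> (\<forall>i. projective_summand (r i) (P i)) \<and>
    (\<forall>i>l. P i = {0\<^sub>v (r i)})}"
  proof (rule Inf_greatest)
    fix k assume "k \<in> {enat l | l. \<exists>r P A. resolution I r P A \<and> (\<forall>i. projective_summand (r i) (P i)) \<and>
      (\<forall>i>l. P i = {0\<^sub>v (r i)})}"
    then obtain m r' P' A' where k: "k = enat m" and R': "resolution I r' P' A'"
      and proj: "\<forall>i. projective_summand (r' i) (P' i)" and zero: "\<forall>i>m. P' i = {0\<^sub>v (r' i)}" by blast
    have "l \<le> m"
    proof (rule ccontr)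
      assume "\<not> l \<le> m"
      then have "P' l = {0\<^sub>v (r' l)}" using zero by simp
      from minimal_resolution_le_projective[OF D(1) comm_ring_hom_lookup_0 D(4) R' spec[OF proj] this]
      show False using l(1) by simp
    qed
    then show "enat l \<le> k" by (simp add: k)
  qed
qed

section \<open>The cover ideal\<close>

context unmixed_labelled_graph
begin

lemma cover_ideal_eq:
  "(cover_ideal E :: ('v, 'k::field) mpoly set) =
    {\<Sum>C\<in>cover_family. cubical_family.gen {1..n} (\<lambda>s. var (x s)) (\<lambda>s. var (y s)) C * c C | c. True}"
proof -
  interpret regular_cubical_family "{1..n}" cover_family
    "\<lambda>s. var (x s) :: ('v, 'k) mpoly" "\<lambda>s. var (y s)" by (rule regular_cubical_family_cover_family)
  have "gen C = (\<Prod>v\<in>cover_of C. var v)" if "C \<in> cover_family" for C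
    unfolding gen_def prod_var by (rule gen_eq_monomial) (use that in \<open>simp add: cover_family_def\<close>)
  then have "(\<lambda>C. \<Prod>v\<in>C. var v) ` min_vertex_covers E = gen ` cover_family"
    unfolding min_vertex_covers_eq image_image by (intro image_cong) simp_all
  then show ?thesis unfolding cover_ideal_def using ideal_generated_by_image[OF finite_F, of gen] by simp
qed

text \<open>Ranks and shifts are expressed through the graph alone, with no trace of the coefficient
  field; independence of the characteristic rests on this.\<close>

lemma cover_ideal_resolution:
  "\<exists>A. minimal_graded_free_resolution (cover_ideal E :: ('v, 'k::field) mpoly set)
    (\<lambda>i. replicate (\<Sum>C\<in>min_vertex_covers E. card (cover_exchanges E n x y C) choose i) (int (n + i))) A"
proof -
  interpret regular_cubical_family "{1..n}" cover_family
    "\<lambda>s. var (x s) :: ('v, 'k) mpoly" "\<lambda>s. var (y s)" by (rule regular_cubical_family_cover_family)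
  have "homogeneous (int n) (gen C)" if "C \<in> cover_family" for C
  proof -
    have C: "C \<subseteq> {1..n}" using that by (simp add: cover_family_def)
    show ?thesis unfolding gen_def gen_eq_monomial[OF C]
      by (simp add: homogeneous_def mon_degree_squarefree_exp card_cover_of[OF C])
  qed
  from minimal_graded_free_resolution_diff_mat[OF regular_cubical_family_axioms cover_ideal_eq this]
  have "minimal_graded_free_resolution (cover_ideal E :: ('v, 'k) mpoly set)
    (\<lambda>i. replicate (\<Sum>C\<in>cover_family. card (exchange_set cover_family C) choose i) (int (n + i))) diff_mat"
    by blast
  moreover have "(\<Sum>C\<in>min_vertex_covers E. card (cover_exchanges E n x y C) choose i) =
    (\<Sum>C\<in>cover_family. card (exchange_set cover_family C) choose i)" for i
    unfolding min_vertex_covers_eq sum.reindex[OF inj_cover_of] comp_def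
    by (intro sum.cong) (simp_all add: card_cover_exchanges)
  ultimately show ?thesis by auto
qed

end

theorem corollary3p6:
  fixes E :: "'v::finite set set" and n :: nat and x y :: "nat \<Rightarrow> 'v"
  assumes "simple_graph E"
    and "very_well_covered TYPE('k::field) E"
    and "cohen_macaulay_graph TYPE('k) E"
    and "standard_labelling E n x y"
  shows "(\<forall>i. betti i (cover_ideal E :: ('v, 'k) mpoly set) =
            (\<Sum>C\<in>min_vertex_covers E. card (cover_exchanges E n x y C) choose i)) \<and>
         projective_dimension (cover_ideal E :: ('v, 'k) mpoly set) =
            enat (Max ((\<lambda>C. card (cover_exchanges E n x y C)) ` min_vertex_covers E)) \<and>
         (\<forall>i j. graded_betti i j (cover_ideal E :: ('v, 'k) mpoly set) =
            graded_betti i j (cover_ideal E :: ('v, 'l::field) mpoly set))"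
proof -
  interpret unmixed_labelled_graph E n x y
    using assms by unfold_locales (simp_all add: very_well_covered_def)
  let ?e = "\<lambda>C. card (cover_exchanges E n x y C)"
  let ?r = "\<lambda>i. \<Sum>C\<in>min_vertex_covers E. ?e C choose i"
  \<comment> \<open>The same shifts serve both fields, and graded Betti numbers only count entries
    of these lists.\<close>
  let ?d = "\<lambda>i. replicate (?r i) (int (n + i))"
  obtain A where A: "minimal_graded_free_resolution (cover_ideal E :: ('v, 'k) mpoly set) ?d A"
    using cover_ideal_resolution by blast
  obtain A' where A': "minimal_graded_free_resolution (cover_ideal E :: ('v, 'l) mpoly set) ?d A'"
    using cover_ideal_resolution by blast
  let ?l = "Max (?e ` min_vertex_covers E)"
  have fin: "finite (min_vertex_covers E)" by simp
  have ne: "min_vertex_covers E \<noteq> {}" using x_min_cover by blast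
  have "?l \<in> ?e ` min_vertex_covers E" using ne by (intro Max_in) auto
  then obtain C where C: "C \<in> min_vertex_covers E" "?e C = ?l" by auto
  \<comment> \<open>A cover attaining the maximum contributes the binomial coefficient
    \<open>?l choose ?l\<close>, which is 1.\<close>
  have "?r ?l \<noteq> 0" using C fin by (auto simp: sum_eq_0_iff intro!: bexI[of _ C])
  moreover have "?r i = 0" if "i > ?l" for i
  proof (rule sum.neutral, rule ballI)
    fix D assume "D \<in> min_vertex_covers E"
    then have "?e D \<le> ?l" using fin by (intro Max_ge) auto
    then show "?e D choose i = 0" using that by (simp add: binomial_eq_0)
  qed
  ultimately have "projective_dimension (cover_ideal E :: ('v, 'k) mpoly set) = enat ?l"
    by (rule projective_dimension_eq[OF A])
  then show ?thesis
    unfolding betti_def graded_betti_def minimal_shifts_eq[OF A] minimal_shifts_eq[OF A'] by simp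
qed

end
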